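(* Suppose that the numerical flux $\hat{\mathbf f}$ is entropy stable for $U$. Then every solution $\mathbf u(\cdot,t)\in(\mathbb V^k)^m$ of Scheme B' satisfies the local semi-discrete entropy inequality $$\frac{d}{dt}\int_{I_j}U(\mathbf u)\,dx+\hat{\mathcal F}_{j+\frac12}-\hat{\mathcal F}_{j-\frac12}\le0,\qquad j=1,\dots,N,$$ where $\hat{\mathcal F}_{j+\frac12}=\hat{\mathcal F}(\mathbf u^-_{j+\frac12},\mathbf u^+_{j+\frac12})$ and $$\hat{\mathcal F}(\mathbf u^-,\mathbf u^+):=\nabla U(\mathbf u^-)\cdot\hat{\mathbf f}(\mathbf u^-,\mathbf u^+)-\psi(\mathbf u^-).$$
   Context: Consider an $m\times m$ system $\mathbf u_t+\mathbf f(\mathbf u)_x=\mathbf 0$ on an interval $I$, with $\mathbf f:\Omega'\to\mathbb R^m$ smooth on an open set $\Omega'\subset\mathbb R^m$; vectors are columns and $|\cdot|$ is the Euclidean norm. $(U,\mathcal F)$ is an entropy pair: $U\in C^3(\Omega')$ strictly convex ($\nabla^2U>0$ on $\Omega'$), $\nabla\mathcal F(\mathbf u)^T=\nabla U(\mathbf u)^T\nabla\mathbf f(\mathbf u)$, and $\psi(\mathbf u):=\nabla U(\mathbf u)^T\mathbf f(\mathbf u)-\mathcal F(\mathbf u)$. All states considered, including the convex hulls $\mathrm{co}(\mathbf u(I_j))$ of $\mathbf u(I_j)=\{\mathbf u(x):x\in I_j\}$, lie in $\Omega'$. $I$ is divided into cells $I_j=[x_{j-\frac12},x_{j+\frac12}]$,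 $j=1,\dots,N$, $h_j=|I_j|$. Fix $k\ge1$; $\mathbb V^k=\{v\in L^2(I): v|_{I_j}\in\mathbb P^k(I_j)\ \forall j\}$ ($\mathbb P^k$: polynomials of degree $\le k$); $\pi$ is the $L^2$-projection onto $\mathbb V^k$, acting componentwise; superscripts $\pm$ at $x_{j+\frac12}$ denote one-sided limits; $\overline{\mathbf u}_j$ is the average on $I_j$; exterior traces at the end-points of $I$ are supplied by the boundary conditions. Put $\hat{\mathbf f}_{j+\frac12}=\hat{\mathbf f}(\mathbf u^-_{j+\frac12},\mathbf u^+_{j+\frac12})$, $\mathbf H^+_{j-\frac12}=\hat{\mathbf f}_{j-\frac12}-\mathbf f(\mathbf u^+_{j-\frac12})$, $\mathbf H^-_{j+\frac12}=-\hat{\mathbf f}_{j+\frac12}+\mathbf f(\mathbf u^-_{j+\frac12})$. Entropy stable flux: a consistent two-point numerical flux ($\hat{\mathbf f}(\mathbf u,\mathbf u)=\mathbf f(\mathbf u)$) with $$\hat{\mathbf f}(\mathbf u^-,\mathbf u^+)\cdot(\nabla U(\mathbf u^+)-\nabla U(\mathbf u^-))-(\psi(\mathbf u^+)-\psi(\mathbf u^-))\le0 .$$ Let $\max_{\mathbf w\in\mathrm{co}(\mathbf u(I_j))}|\partial^3U(\mathbf w)|$ be the maximum over $\mathbf w\in\mathrm{co}(\mathbf u(I_j))$ and $1\le i_1,i_2,i_3\le m$ of $|\partial^3U(\mathbf w)/\partial u_{i_1}\partial u_{i_2}\partial u_{i_3}|$, and let $\sigma_{\min}(\nabla^2U)$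 be the minimum eigenvalue of the Hessian. Constants: $C_k>0$ is the optimal constant with $\|p\|_{L^4(I_j)}\le\sqrt{C_k}\,h_j^{-1/4}\|p\|_{L^2(I_j)}$ for all $p\in\mathbb P^k(I_j)$. $\beta_k$ is a constant depending only on $k$ such that, for every such $U$, $\mathbf u\in(\mathbb V^k)^m$ and $j$, both $|\pi[\nabla U(\mathbf u)-\nabla U(\mathbf u^+_{j-\frac12})](x^+_{j-\frac12})|$ and $|\pi[\nabla U(\mathbf u)-\nabla U(\mathbf u^-_{j+\frac12})](x^-_{j+\frac12})|$ are at most $\frac{m^{3/2}\beta_k}{2h_j}\max_{\mathbf w\in\mathrm{co}(\mathbf u(I_j))}|\partial^3U(\mathbf w)|\int_{I_j}|\mathbf u-\overline{\mathbf u}_j|^2dx$ (such constants exist; e.g. $\beta_k=2\mathcal A_k$ with $$\mathcal A_k=\sup_{p}\frac{\int_{-1}^1|K_k^-(\xi)||p(\xi)-p(-1)|^2d\xi}{\int_{-1}^1|p(\xi)|^2d\xi},\quad K_k^-(\xi)=\sum_{i=0}^k\tfrac{2i+1}{2}(-1)^iP_i(\xi),$$ the supremum over nonzero $p\in\mathbb P^k([-1,1])$ of zero average and $P_i$ the Legendre polynomials with $P_i(1)=1$). Damping coefficient: $$B'_j[\mathbf u;U]:=\frac{m^{3/2}}2\,\frac{\max_{\mathbf w\in\mathrm{co}(\mathbf u(I_j))}|\partial^3U(\mathbf w)|}{\min_{\mathbf w\in\mathrm{co}(\mathbf u(I_j))}|\sigma_{\min}(\nabla^2U(\mathbf w))|}\Big\{\frac{C_k}{\sqrt{h_j}}\|\mathbf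 f(\mathbf u)_x-\pi[\mathbf f(\mathbf u)_x]\|_{L^2(I_j)}+\frac{\beta_k}{h_j}\big(|\mathbf H^+_{j-\frac12}|+|\mathbf H^-_{j+\frac12}|\big)\Big\}.$$ Scheme B': seek $\mathbf u(\cdot,t)\in(\mathbb V^k)^m$ such that for all $\mathbf v\in(\mathbb V^k)^m$ and all $j$, $$\int_{I_j}\mathbf u_t\cdot\mathbf v\,dx-\int_{I_j}\mathbf f(\mathbf u)\cdot\mathbf v_x\,dx+\hat{\mathbf f}_{j+\frac12}\cdot\mathbf v^-_{j+\frac12}-\hat{\mathbf f}_{j-\frac12}\cdot\mathbf v^+_{j-\frac12}=-B'_j[\mathbf u;U]\int_{I_j}(\mathbf u-\overline{\mathbf u}_j)\cdot\mathbf v\,dx.$$ *)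

theory Defs
  imports "HOL-Analysis.Analysis" "HOL-Computational_Algebra.Polynomial"
begin

section \<open>Differential calculus on open subsets of \<open>real ^ 'm\<close>\<close>

definition partial :: "'m::finite \<Rightarrow> (real ^ 'm \<Rightarrow> 'b::real_normed_vector) \<Rightarrow> real ^ 'm \<Rightarrow> 'b" where
  "partial i g w = frechet_derivative g (at w) (axis i 1)"

(* The class C^n on an open set S. *)
fun Cn_on :: "nat \<Rightarrow> (real ^ 'm::finite \<Rightarrow> 'b::real_normed_vector) \<Rightarrow> (real ^ 'm) set \<Rightarrow> bool" where
  "Cn_on 0 g S \<longleftrightarrow> continuous_on S g"
| "Cn_on (Suc n) g S \<longleftrightarrow>
     (\<forall>w\<in>S. g differentiable (at w)) \<and> (\<forall>i. Cn_on n (partial i g) S)"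

definition smooth_on :: "(real ^ 'm::finite \<Rightarrow> 'b::real_normed_vector) \<Rightarrow> (real ^ 'm) set \<Rightarrow> bool" where
  "smooth_on g S \<longleftrightarrow> (\<forall>n. Cn_on n g S)"

definition grad :: "(real ^ 'm::finite \<Rightarrow> real) \<Rightarrow> real ^ 'm \<Rightarrow> real ^ 'm" where
  "grad U w = (\<chi> i. partial i U w)"

definition hess :: "(real ^ 'm::finite \<Rightarrow> real) \<Rightarrow> real ^ 'm \<Rightarrow> real ^ 'm ^ 'm" where
  "hess U w = (\<chi> i j. partial i (partial j U) w)"

definition sigma_min :: "real ^ 'm ^ 'm::finite \<Rightarrow> real" where
  "sigma_min A = (LEAST s. \<exists>z. z \<noteq> 0 \<and> A *v z = s *\<^sub>R z)"


section \<open>Entropy pairs and numerical fluxes\<close>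

definition convex_entropy :: "(real ^ 'm::finite) set \<Rightarrow> (real ^ 'm \<Rightarrow> real) \<Rightarrow> bool" where
  "convex_entropy \<Omega> U \<longleftrightarrow> Cn_on 3 U \<Omega> \<and> (\<forall>w\<in>\<Omega>. \<forall>z. z \<noteq> 0 \<longrightarrow> 0 < z \<bullet> (hess U w *v z))"

definition entropy_pair ::
  "(real ^ 'm::finite) set \<Rightarrow> (real ^ 'm \<Rightarrow> real ^ 'm) \<Rightarrow> (real ^ 'm \<Rightarrow> real) \<Rightarrow> (real ^ 'm \<Rightarrow> real) \<Rightarrow> bool"
where
  "entropy_pair \<Omega> f U F \<longleftrightarrow> convex_entropy \<Omega> U \<and>
     (\<forall>w\<in>\<Omega>. F differentiable (at w) \<and>
             grad F w = grad U w v* matrix (frechet_derivative f (at w)))"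

definition potential ::
  "(real ^ 'm::finite \<Rightarrow> real ^ 'm) \<Rightarrow> (real ^ 'm \<Rightarrow> real) \<Rightarrow> (real ^ 'm \<Rightarrow> real) \<Rightarrow> real ^ 'm \<Rightarrow> real"
where
  "potential f U F w = grad U w \<bullet> f w - F w"

definition entropy_stable ::
  "(real ^ 'm::finite) set \<Rightarrow> (real ^ 'm \<Rightarrow> real ^ 'm) \<Rightarrow> (real ^ 'm \<Rightarrow> real) \<Rightarrow> (real ^ 'm \<Rightarrow> real)
     \<Rightarrow> (real ^ 'm \<Rightarrow> real ^ 'm \<Rightarrow> real ^ 'm) \<Rightarrow> bool"
where
  "entropy_stable \<Omega> f U F fhat \<longleftrightarrow>
     (\<forall>w\<in>\<Omega>. fhat w w = f w) \<and>
     (\<forall>a\<in>\<Omega>. \<forall>b\<in>\<Omega>. fhat a b \<bullet> (grad U b - grad U a) - (potential f U F b - potential f U F a) \<le> 0)"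

definition entropy_flux ::
  "(real ^ 'm::finite \<Rightarrow> real ^ 'm) \<Rightarrow> (real ^ 'm \<Rightarrow> real) \<Rightarrow> (real ^ 'm \<Rightarrow> real)
     \<Rightarrow> (real ^ 'm \<Rightarrow> real ^ 'm \<Rightarrow> real ^ 'm) \<Rightarrow> real ^ 'm \<Rightarrow> real ^ 'm \<Rightarrow> real"
where
  "entropy_flux f U F fhat a b = grad U a \<bullet> fhat a b - potential f U F a"


section \<open>Mesh, broken polynomial space, traces\<close>

(* Nodes are numbered by the right end-point of a cell: "x j" is the node with index j + 1/2,
   0 \<le> j \<le> N, so that the j-th cell, 1 \<le> j \<le> N, is [x (j - 1), x j]. *)
definition mesh :: "nat \<Rightarrow> (nat \<Rightarrow> real) \<Rightarrow> bool" where
  "mesh N x \<longleftrightarrow> 0 < N \<and> strict_mono_on {0..N} x"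

abbreviation cell :: "(nat \<Rightarrow> real) \<Rightarrow> nat \<Rightarrow> real set" where
  "cell x j \<equiv> {x (j - 1)..x j}"

abbreviation open_cell :: "(nat \<Rightarrow> real) \<Rightarrow> nat \<Rightarrow> real set" where
  "open_cell x j \<equiv> {x (j - 1)<..<x j}"

abbreviation width :: "(nat \<Rightarrow> real) \<Rightarrow> nat \<Rightarrow> real" where
  "width x j \<equiv> x j - x (j - 1)"

(* Elements of the broken polynomial space are L^2 functions; their representatives are
   constrained on the open cells only, and nothing below depends on the values at the nodes or
   outside the interval. *)
definition Vk :: "nat \<Rightarrow> nat \<Rightarrow> (nat \<Rightarrow> real) \<Rightarrow> (real \<Rightarrow> real) set" where
  "Vk k N x = {v. \<forall>j\<in>{1..N}. \<exists>p. degree p \<le> k \<and> (\<forall>y\<in>open_cell x j. v y = poly p y)}"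

definition Vkm :: "nat \<Rightarrow> nat \<Rightarrow> (nat \<Rightarrow> real) \<Rightarrow> (real \<Rightarrow> real ^ 'm::finite) set" where
  "Vkm k N x = {v. \<forall>i. (\<lambda>y. v y $ i) \<in> Vk k N x}"

definition L2_proj :: "nat \<Rightarrow> nat \<Rightarrow> (nat \<Rightarrow> real) \<Rightarrow> (real \<Rightarrow> real) \<Rightarrow> real \<Rightarrow> real" where
  "L2_proj k N x g = (SOME p. p \<in> Vk k N x \<and>
     (\<forall>v\<in>Vk k N x. integral {x 0..x N} (\<lambda>y. p y * v y) = integral {x 0..x N} (\<lambda>y. g y * v y)))"

definition L2_proj_vec ::
  "nat \<Rightarrow> nat \<Rightarrow> (nat \<Rightarrow> real) \<Rightarrow> (real \<Rightarrow> real ^ 'm::finite) \<Rightarrow> real \<Rightarrow> real ^ 'm" where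
  "L2_proj_vec k N x g y = (\<chi> i. L2_proj k N x (\<lambda>z. g z $ i) y)"

abbreviation left_lim :: "(real \<Rightarrow> 'b::t2_space) \<Rightarrow> real \<Rightarrow> 'b" where
  "left_lim v y \<equiv> Lim (at_left y) v"

abbreviation right_lim :: "(real \<Rightarrow> 'b::t2_space) \<Rightarrow> real \<Rightarrow> 'b" where
  "right_lim v y \<equiv> Lim (at_right y) v"

(* One-sided traces at the node "x j"; a and b are the exterior traces prescribed by the boundary
   conditions at the left and right end-point of the interval. *)
definition trace_minus :: "(nat \<Rightarrow> real) \<Rightarrow> 'b::t2_space \<Rightarrow> (real \<Rightarrow> 'b) \<Rightarrow> nat \<Rightarrow> 'b" where
  "trace_minus x a v j = (if j = 0 then a else left_lim v (x j))"

definition trace_plus :: "nat \<Rightarrow> (nat \<Rightarrow> real) \<Rightarrow> 'b::t2_space \<Rightarrow> (real \<Rightarrow> 'b) \<Rightarrow> nat \<Rightarrow> 'b" where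
  "trace_plus N x b v j = (if j = N then b else right_lim v (x j))"

definition cell_avg :: "(nat \<Rightarrow> real) \<Rightarrow> nat \<Rightarrow> (real \<Rightarrow> real ^ 'm::finite) \<Rightarrow> real ^ 'm" where
  "cell_avg x j v = (1 / width x j) *\<^sub>R integral (cell x j) v"

definition L2_norm :: "real set \<Rightarrow> (real \<Rightarrow> 'b::real_normed_vector) \<Rightarrow> real" where
  "L2_norm S g = sqrt (integral S (\<lambda>y. (norm (g y))\<^sup>2))"

definition L4_norm :: "real set \<Rightarrow> (real \<Rightarrow> 'b::real_normed_vector) \<Rightarrow> real" where
  "L4_norm S g = root 4 (integral S (\<lambda>y. norm (g y) ^ 4))"

(* The range of v on the closed cell: at the end-points the polynomial on the cell takes the
   one-sided limits from inside. *)
definition cell_range :: "(nat \<Rightarrow> real) \<Rightarrow> nat \<Rightarrow> (real \<Rightarrow> real ^ 'm::finite) \<Rightarrow> (real ^ 'm) set" where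
  "cell_range x j v = v ` open_cell x j \<union> {right_lim v (x (j - 1)), left_lim v (x j)}"

definition states_in :: "nat \<Rightarrow> (nat \<Rightarrow> real) \<Rightarrow> (real ^ 'm::finite) set \<Rightarrow> (real \<Rightarrow> real ^ 'm) \<Rightarrow> bool"
where
  "states_in N x \<Omega> v \<longleftrightarrow> (\<forall>j\<in>{1..N}. convex hull (cell_range x j v) \<subseteq> \<Omega>)"


section \<open>Constants and damping coefficient\<close>

(* For continuous integrands on the compact hull of a cell range, the supremum and the infimum
   below are attained. *)
definition max_d3 :: "(real ^ 'm::finite \<Rightarrow> real) \<Rightarrow> (real ^ 'm) set \<Rightarrow> real" where
  "max_d3 U S = (SUP (w, i1, i2, i3) \<in> S \<times> UNIV \<times> UNIV \<times> UNIV.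
                   \<bar>partial i1 (partial i2 (partial i3 U)) w\<bar>)"

definition min_sigma :: "(real ^ 'm::finite \<Rightarrow> real) \<Rightarrow> (real ^ 'm) set \<Rightarrow> real" where
  "min_sigma U S = (INF w\<in>S. \<bar>sigma_min (hess U w)\<bar>)"

(* The optimal constant in the inverse inequality between L^4 and L^2 on polynomials of degree
   at most k. The scaling in h makes it independent of the interval. *)
definition Ck_const :: "nat \<Rightarrow> real" where
  "Ck_const k = Inf {C. 0 < C \<and> (\<forall>a b p. a < b \<and> degree p \<le> k \<longrightarrow>
     L4_norm {a..b} (poly p) \<le> sqrt C * (b - a) powr (-1/4) * L2_norm {a..b} (poly p))}"

(* Admissibility of a constant depending only on k: the same bound is required for all meshes,
   all state domains, all strictly convex entropies, and all piecewise polynomial states. The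
   type argument carries the number m of components. *)
definition trace_constant :: "'m::finite itself \<Rightarrow> nat \<Rightarrow> real \<Rightarrow> bool" where
  "trace_constant TYPE('m) k \<beta> \<longleftrightarrow>
    (\<forall>N x (\<Omega> :: (real ^ 'm) set) U u. \<forall>j\<in>{1..N}.
      mesh N x \<and> open \<Omega> \<and> convex_entropy \<Omega> U \<and> u \<in> Vkm k N x \<and> states_in N x \<Omega> u \<longrightarrow>
      (let a = right_lim u (x (j - 1)); b = left_lim u (x j);
           R = real CARD('m) powr (3/2) * \<beta> / (2 * width x j)
                 * max_d3 U (convex hull (cell_range x j u))
                 * integral (cell x j) (\<lambda>y. (norm (u y - cell_avg x j u))\<^sup>2)
       in norm (right_lim (L2_proj_vec k N x (\<lambda>y. grad U (u y) - grad U a)) (x (j - 1))) \<le> R \<and>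
          norm (left_lim (L2_proj_vec k N x (\<lambda>y. grad U (u y) - grad U b)) (x j)) \<le> R))"

definition num_flux_at ::
  "nat \<Rightarrow> (nat \<Rightarrow> real) \<Rightarrow> (real ^ 'm::finite \<Rightarrow> real ^ 'm \<Rightarrow> 'b) \<Rightarrow> real ^ 'm \<Rightarrow> real ^ 'm
     \<Rightarrow> (real \<Rightarrow> real ^ 'm) \<Rightarrow> nat \<Rightarrow> 'b" where
  "num_flux_at N x g a b u j = g (trace_minus x a u j) (trace_plus N x b u j)"

(* f(u)_x; meaningful on the open cells, which suffices under the integral. *)
definition flux_deriv :: "(real ^ 'm::finite \<Rightarrow> real ^ 'm) \<Rightarrow> (real \<Rightarrow> real ^ 'm) \<Rightarrow> real \<Rightarrow> real ^ 'm"
where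
  "flux_deriv f u y = vector_derivative (\<lambda>z. f (u z)) (at y)"

definition damping ::
  "nat \<Rightarrow> real \<Rightarrow> nat \<Rightarrow> (nat \<Rightarrow> real) \<Rightarrow> (real ^ 'm::finite \<Rightarrow> real ^ 'm) \<Rightarrow> (real ^ 'm \<Rightarrow> real)
     \<Rightarrow> (real ^ 'm \<Rightarrow> real ^ 'm \<Rightarrow> real ^ 'm) \<Rightarrow> real ^ 'm \<Rightarrow> real ^ 'm
     \<Rightarrow> (real \<Rightarrow> real ^ 'm) \<Rightarrow> nat \<Rightarrow> real"
where
  "damping k \<beta> N x f U fhat a b u j =
    (let h = width x j;
         K = convex hull (cell_range x j u);
         Hplus = num_flux_at N x fhat a b u (j - 1) - f (right_lim u (x (j - 1)));
         Hminus = - num_flux_at N x fhat a b u j + f (left_lim u (x j))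
     in real CARD('m) powr (3/2) / 2 * (max_d3 U K / min_sigma U K)
        * (Ck_const k / sqrt h
             * L2_norm (cell x j) (\<lambda>y. flux_deriv f u y - L2_proj_vec k N x (flux_deriv f u) y)
           + \<beta> / h * (norm Hplus + norm Hminus)))"


section \<open>The semi-discrete scheme\<close>

(* "u t" is the discrete solution at time t, "uL t" and "uR t" are the exterior traces. On a time
   interval T containing an end-point, time derivatives there are one-sided. *)
definition scheme_solution ::
  "nat \<Rightarrow> real \<Rightarrow> nat \<Rightarrow> (nat \<Rightarrow> real) \<Rightarrow> (real ^ 'm::finite \<Rightarrow> real ^ 'm) \<Rightarrow> (real ^ 'm \<Rightarrow> real)
     \<Rightarrow> (real ^ 'm \<Rightarrow> real ^ 'm \<Rightarrow> real ^ 'm) \<Rightarrow> (real \<Rightarrow> real ^ 'm) \<Rightarrow> (real \<Rightarrow> real ^ 'm)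
     \<Rightarrow> real set \<Rightarrow> (real \<Rightarrow> real \<Rightarrow> real ^ 'm) \<Rightarrow> bool"
where
  "scheme_solution k \<beta> N x f U fhat uL uR T u \<longleftrightarrow>
    (\<forall>t\<in>T. u t \<in> Vkm k N x \<and>
      (\<forall>j\<in>{1..N}. \<forall>y\<in>open_cell x j. (\<lambda>s. u s y) differentiable (at t within T)) \<and>
      (\<forall>v\<in>Vkm k N x. \<forall>j\<in>{1..N}.
         integral (cell x j) (\<lambda>y. vector_derivative (\<lambda>s. u s y) (at t within T) \<bullet> v y)
         - integral (cell x j) (\<lambda>y. f (u t y) \<bullet> vector_derivative v (at y))
         + num_flux_at N x fhat (uL t) (uR t) (u t) j \<bullet> left_lim v (x j)
         - num_flux_at N x fhat (uL t) (uR t) (u t) (j - 1) \<bullet> right_lim v (x (j - 1))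
         = - damping k \<beta> N x f U fhat (uL t) (uR t) (u t) j
             * integral (cell x j) (\<lambda>y. (u t y - cell_avg x j (u t)) \<bullet> v y)))"

end

theory Submission
  imports Defs
begin

text \<open>
  Test the scheme on a cell with the projection \<open>v\<close> of the entropy variables \<open>w = \<nabla>U(u)\<close>. The time derivative of
  the state is a polynomial on the cell, so its product with \<open>v\<close> integrates to the time derivative of the entropy
  (\<open>has_derivative_integral_entropy\<close>). If \<open>v\<close> were equal to \<open>w\<close>, the volume term would be the exact
  derivative of \<open>F(u)\<close>, the boundary terms would be the two numerical entropy fluxes, with a favourable jump
  term from entropy stability on the left, and no damping would be needed. Replacing \<open>w\<close> by \<open>v\<close> produces
  three defects. The volume defect is the integral of \<open>(f(u)\<^sub>x - \<pi>[f(u)\<^sub>x]) \<bullet> (w - v)\<close>, because \<open>w - v\<close>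
  is orthogonal to polynomials (\<open>flux_volume_term\<close>). The two boundary defects are the products of the flux
  jumps with the trace errors of \<open>v\<close>.

  All three are quadratic in the deviation of \<open>u\<close> from its cell average, in the sense that they are bounded by
  \<open>Q\<close>, the integral of the squared deviation, times the coefficients that appear in the damping. For the trace
  errors this is the definition of the trace constant. For the volume defect, \<open>v\<close> is at least as close to
  \<open>w\<close> as the first-order Taylor polynomial of \<open>\<nabla>U\<close> at the average, whose error is bounded by third derivatives
  of \<open>U\<close> (\<open>grad_taylor\<close>) times the squared deviation; the \<open>L\<^sup>2\<close>-norm of the latter is an \<open>L\<^sup>4\<close>-norm, and
  the inverse inequality returns to \<open>L\<^sup>2\<close> (\<open>entropy_variable_projection_error\<close>).

  The damping term, on the other hand, dissipates at least the coefficient times \<open>\<sigma> * Q\<close>, where \<open>\<sigma>\<close> is the least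
  eigenvalue of the Hessian on the hull of the states: the average lies in this convex set, and \<open>\<nabla>U\<close> is
  strongly monotone there (\<open>damping_coercive\<close>). The coefficient is the sum of the bounds on the defects divided by
  \<open>\<sigma> * Q\<close>, so the damping absorbs them (\<open>damping_absorbs_defects\<close>).

  Several facts of calculus and linear algebra enter on the way: the symmetry of second derivatives and the
  variational description of the least eigenvalue, without which \<open>\<sigma>\<close> would not bound the Hessian from below, and
  orthonormal polynomials, which give the projection and show that the inverse constant is finite.
\<close>

section \<open>Calculus with partial derivatives\<close>

lemma has_derivative_partial:
  fixes g :: "real ^ 'm::finite \<Rightarrow> 'b::real_normed_vector"
  assumes "g differentiable (at w)"
  shows "(g has_derivative (\<lambda>h. \<Sum>i\<in>UNIV. h $ i *\<^sub>R partial i g w)) (at w)"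
proof -
  let ?D = "frechet_derivative g (at w)"
  have D: "(g has_derivative ?D) (at w)"
    using assms frechet_derivative_works by blast
  have lin: "linear ?D"
    using D has_derivative_linear by blast
  have "?D h = (\<Sum>i\<in>UNIV. h $ i *\<^sub>R partial i g w)" for h
  proof -
    have "?D h = ?D (\<Sum>i\<in>UNIV. h $ i *\<^sub>R axis i 1)"
      by (metis basis_expansion scalar_mult_eq_scaleR)
    also have "\<dots> = (\<Sum>i\<in>UNIV. h $ i *\<^sub>R partial i g w)"
      by (simp add: linear_sum[OF lin] linear_cmul[OF lin] partial_def)
    finally show ?thesis .
  qed
  then have "?D = (\<lambda>h. \<Sum>i\<in>UNIV. h $ i *\<^sub>R partial i g w)" by blast
  with D show ?thesis by simp
qed

lemma has_derivative_grad:
  fixes g :: "real ^ 'm::finite \<Rightarrow> real"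
  assumes "g differentiable (at w)"
  shows "(g has_derivative (\<lambda>h. grad g w \<bullet> h)) (at w)"
proof -
  have "(\<lambda>h. \<Sum>i\<in>UNIV. h $ i *\<^sub>R partial i g w) = (\<lambda>h. grad g w \<bullet> h)"
    by (simp add: grad_def inner_vec_def mult.commute)
  with has_derivative_partial[OF assms] show ?thesis by simp
qed

lemma has_real_derivative_line:
  fixes g :: "real ^ 'm::finite \<Rightarrow> real"
  assumes "g differentiable (at (w + s *\<^sub>R z))"
  shows "((\<lambda>s. g (w + s *\<^sub>R z)) has_real_derivative (\<Sum>i\<in>UNIV. z $ i * partial i g (w + s *\<^sub>R z))) (at s within S)"
proof -
  have l: "((\<lambda>s. w + s *\<^sub>R z) has_derivative (\<lambda>r. r *\<^sub>R z)) (at s within S)"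
    by (auto intro!: derivative_eq_intros)
  have "((\<lambda>s. g (w + s *\<^sub>R z)) has_derivative
      (\<lambda>r. \<Sum>i\<in>UNIV. (r *\<^sub>R z) $ i *\<^sub>R partial i g (w + s *\<^sub>R z))) (at s within S)"
    using has_derivative_compose[OF l has_derivative_partial[OF assms]] by simp
  moreover have "(\<lambda>r. \<Sum>i\<in>UNIV. (r *\<^sub>R z) $ i *\<^sub>R partial i g (w + s *\<^sub>R z))
      = (*) (\<Sum>i\<in>UNIV. z $ i * partial i g (w + s *\<^sub>R z))"
    by (auto simp: sum_distrib_left mult_ac intro!: ext)
  ultimately show ?thesis by (simp add: has_field_derivative_def)
qed

lemma has_real_derivative_line_axis:
  fixes g :: "real ^ 'm::finite \<Rightarrow> real"
  assumes "g differentiable (at (w + s *\<^sub>R axis i 1))"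
  shows "((\<lambda>s. g (w + s *\<^sub>R axis i 1)) has_real_derivative partial i g (w + s *\<^sub>R axis i 1)) (at s)"
proof -
  have "(\<Sum>l\<in>UNIV. axis i 1 $ l * partial l g (w + s *\<^sub>R axis i 1)) = partial i g (w + s *\<^sub>R axis i 1)"
    by (simp add: axis_def if_distrib[of "\<lambda>c. c * _"] cong: if_cong)
  with has_real_derivative_line[OF assms] show ?thesis by metis
qed

text \<open>Two applications of the mean value theorem, first in direction \<open>i\<close> and then in direction
  \<open>j\<close>. The second difference on the left is symmetric in the two directions, so letting \<open>r\<close> tend to
  \<open>0\<close> identifies the two mixed derivatives.\<close>

lemma mixed_difference:
  fixes U :: "real ^ 'm::finite \<Rightarrow> real"
  assumes r: "0 < r" and B: "ball w (3 * r) \<subseteq> S"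
    and d1: "\<And>v. v \<in> S \<Longrightarrow> U differentiable (at v)"
    and d2: "\<And>v l. v \<in> S \<Longrightarrow> partial l U differentiable (at v)"
  obtains v where "v \<in> ball w (3 * r)"
    "U (w + r *\<^sub>R axis i 1 + r *\<^sub>R axis j 1) - U (w + r *\<^sub>R axis i 1) - U (w + r *\<^sub>R axis j 1) + U w
      = r\<^sup>2 * partial j (partial i U) v"
proof -
  define e where "e = (\<lambda>l. axis l 1 :: real ^ 'm)"
  have ne: "norm (e l) = 1" for l by (simp add: e_def)
  \<comment> \<open>The far corner is at distance at most \<open>2 * r\<close>, hence inside the ball, with room to spare.\<close>
  have mem: "w + s *\<^sub>R e i + t *\<^sub>R e j \<in> ball w (3 * r)" if "0 \<le> s" "s \<le> r" "0 \<le> t" "t \<le> r" for s t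
  proof -
    have "norm (s *\<^sub>R e i + t *\<^sub>R e j) \<le> s + t"
      using norm_triangle_ineq[of "s *\<^sub>R e i" "t *\<^sub>R e j"] that by (simp add: ne)
    also have "\<dots> < 3 * r" using that r by auto
    finally have "norm (s *\<^sub>R e i + t *\<^sub>R e j) < 3 * r" .
    moreover have "w - (w + s *\<^sub>R e i + t *\<^sub>R e j) = - (s *\<^sub>R e i + t *\<^sub>R e j)" by simp
    ultimately show ?thesis by (simp only: mem_ball dist_norm norm_minus_cancel)
  qed
  have end1: "(w + r *\<^sub>R e j) + s *\<^sub>R e i \<in> S" if "0 \<le> s" "s \<le> r" for s
  proof -
    have "w + s *\<^sub>R e i + r *\<^sub>R e j \<in> S" using mem[of s r] that r B by auto
    then show ?thesis by (simp add: add_ac)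
  qed
  have end0: "w + s *\<^sub>R e i \<in> S" if "0 \<le> s" "s \<le> r" for s
    using mem[of s 0] that r B by auto
  define \<phi> where "\<phi> = (\<lambda>s. U ((w + r *\<^sub>R e j) + s *\<^sub>R e i) - U (w + s *\<^sub>R e i))"
  have "(\<phi> has_real_derivative (partial i U ((w + r *\<^sub>R e j) + s *\<^sub>R e i) - partial i U (w + s *\<^sub>R e i))) (at s)"
    if "0 \<le> s" "s \<le> r" for s
    unfolding \<phi>_def e_def
    by (intro DERIV_diff has_real_derivative_line_axis)
      (use end1[OF that] end0[OF that] d1 in \<open>auto simp: e_def\<close>)
  then obtain s where s: "0 < s" "s < r"
    "\<phi> r - \<phi> 0 = (r - 0) * (partial i U ((w + r *\<^sub>R e j) + s *\<^sub>R e i) - partial i U (w + s *\<^sub>R e i))"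
    using MVT2[OF r, of \<phi> "\<lambda>s. partial i U ((w + r *\<^sub>R e j) + s *\<^sub>R e i) - partial i U (w + s *\<^sub>R e i)"]
    by blast
  have "((\<lambda>t. partial i U ((w + s *\<^sub>R e i) + t *\<^sub>R e j)) has_real_derivative
      partial j (partial i U) ((w + s *\<^sub>R e i) + t *\<^sub>R e j)) (at t)" if "0 \<le> t" "t \<le> r" for t
    unfolding e_def
    by (intro has_real_derivative_line_axis d2) (use mem[of s t] s that B in \<open>auto simp: e_def\<close>)
  then obtain t where t: "0 < t" "t < r"
    "partial i U ((w + s *\<^sub>R e i) + r *\<^sub>R e j) - partial i U ((w + s *\<^sub>R e i) + 0 *\<^sub>R e j)
      = (r - 0) * partial j (partial i U) ((w + s *\<^sub>R e i) + t *\<^sub>R e j)"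
    using MVT2[OF r, of "\<lambda>t. partial i U ((w + s *\<^sub>R e i) + t *\<^sub>R e j)"
        "\<lambda>t. partial j (partial i U) ((w + s *\<^sub>R e i) + t *\<^sub>R e j)"]
    by blast
  have "\<phi> r - \<phi> 0 = r * (r * partial j (partial i U) ((w + s *\<^sub>R e i) + t *\<^sub>R e j))"
    using s(3) t(3) by (simp add: add_ac)
  moreover have "\<phi> r - \<phi> 0 = U (w + r *\<^sub>R e i + r *\<^sub>R e j) - U (w + r *\<^sub>R e i) - U (w + r *\<^sub>R e j) + U w"
    by (simp add: \<phi>_def add_ac)
  ultimately show ?thesis
    using that[of "w + s *\<^sub>R e i + t *\<^sub>R e j"] mem[of s t] s t by (simp add: e_def power2_eq_square)
qed

lemma second_partials_commute:
  fixes U :: "real ^ 'm::finite \<Rightarrow> real"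
  assumes S: "open S" "w \<in> S"
    and d1: "\<And>v. v \<in> S \<Longrightarrow> U differentiable (at v)"
    and d2: "\<And>v l. v \<in> S \<Longrightarrow> partial l U differentiable (at v)"
    and c: "\<And>l l'. continuous_on S (partial l (partial l' U))"
  shows "partial i (partial j U) w = partial j (partial i U) w"
proof -
  obtain R where R: "R > 0" "ball w R \<subseteq> S" using S open_contains_ball by blast
  define r where "r = (\<lambda>n::nat. R / (3 * real (Suc n)))"
  have r0: "r n > 0" for n using R by (simp add: r_def)
  have rR: "3 * r n \<le> R" for n using R by (simp add: r_def field_simps)
  have lim: "r \<longlonglongrightarrow> 0"
  proof -
    have "(\<lambda>n. (R / 3) * (1 / real (Suc n))) \<longlonglongrightarrow> (R / 3) * 0"
      by (intro tendsto_intros lim_1_over_n LIMSEQ_Suc)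
    then show ?thesis by (simp add: r_def[abs_def])
  qed
  have ball: "ball w (3 * r n) \<subseteq> S" for n using R(2) rR[of n] by (auto simp: subset_iff)
  let ?D = "\<lambda>i j n. U (w + r n *\<^sub>R axis i 1 + r n *\<^sub>R axis j 1) - U (w + r n *\<^sub>R axis i 1)
    - U (w + r n *\<^sub>R axis j 1) + U w"
  have key: "(\<lambda>n. ?D i j n / (r n)\<^sup>2) \<longlonglongrightarrow> partial j (partial i U) w" for i j
  proof -
    have "\<exists>v. \<forall>n. v n \<in> ball w (3 * r n) \<and> ?D i j n = (r n)\<^sup>2 * partial j (partial i U) (v n)"
    proof (rule choice, rule allI)
      fix n
      show "\<exists>v. v \<in> ball w (3 * r n) \<and> ?D i j n = (r n)\<^sup>2 * partial j (partial i U) v"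
        using mixed_difference[OF r0 ball d1 d2, of n i j] by metis
    qed
    then obtain v where v: "\<And>n. v n \<in> ball w (3 * r n)"
      "\<And>n. ?D i j n = (r n)\<^sup>2 * partial j (partial i U) (v n)" by blast
    have "v \<longlonglongrightarrow> w"
    proof (rule tendstoI)
      fix e :: real assume "e > 0"
      then have "\<forall>\<^sub>F n in sequentially. r n < e / 3"
        using order_tendstoD(2)[OF lim, of "e / 3"] by simp
      then show "\<forall>\<^sub>F n in sequentially. dist (v n) w < e"
      proof eventually_elim
        case (elim n)
        then show ?case using v(1)[of n] dist_commute[of "v n" w] unfolding mem_ball by linarith
      qed
    qed
    moreover have "isCont (partial j (partial i U)) w"
      using c S continuous_on_eq_continuous_at by blast
    ultimately have "(\<lambda>n. partial j (partial i U) (v n)) \<longlonglongrightarrow> partial j (partial i U) w"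
      using isCont_tendsto_compose by blast
    moreover have "?D i j n / (r n)\<^sup>2 = partial j (partial i U) (v n)" for n
      using v(2)[of n] r0[of n] by (simp only:) simp
    ultimately show ?thesis by simp
  qed
  have sym: "?D i j n / (r n)\<^sup>2 = ?D j i n / (r n)\<^sup>2" for n
  proof -
    have "U (w + r n *\<^sub>R axis i 1 + r n *\<^sub>R axis j 1) = U (w + r n *\<^sub>R axis j 1 + r n *\<^sub>R axis i 1)"
      by (simp add: add_ac)
    then have "?D i j n = ?D j i n" by linarith
    then show ?thesis by (rule arg_cong)
  qed
  have "(\<lambda>n. ?D i j n / (r n)\<^sup>2) \<longlonglongrightarrow> partial i (partial j U) w"
    by (rule Lim_transform_eventually[OF key[of j i]]) (intro always_eventually allI sym[symmetric])
  then show ?thesis by (rule LIMSEQ_unique[OF _ key[of i j]])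
qed

section \<open>Symmetric matrices and strictly convex entropies\<close>

text \<open>The quadratic form attains its minimum on the unit sphere, and the minimiser is an eigenvector: otherwise a
  small step against the residual would lower the Rayleigh quotient. Every eigenvalue is a value of the Rayleigh
  quotient, so the minimum is the least eigenvalue.\<close>

lemma sigma_min_symmetric:
  fixes A :: "real ^ 'm::finite ^ 'm"
  assumes sym: "\<And>x y. x \<bullet> (A *v y) = (A *v x) \<bullet> y"
  shows sigma_min_attained: "\<exists>z. norm z = 1 \<and> sigma_min A = z \<bullet> (A *v z)"
    and sigma_min_le_quadratic: "sigma_min A * (y \<bullet> y) \<le> y \<bullet> (A *v y)"
proof -
  define q where "q = (\<lambda>z. z \<bullet> (A *v z))"
  have "continuous_on (sphere 0 1) q"
    unfolding q_def by (intro continuous_on_inner continuous_on_id matrix_vector_mult_linear_continuous_on)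
  moreover have "axis undefined 1 \<in> sphere (0 :: real ^ 'm) 1" by simp
  ultimately obtain z where z: "z \<in> sphere 0 1" "\<And>y. y \<in> sphere 0 1 \<Longrightarrow> q z \<le> q y"
    using continuous_attains_inf[of "sphere 0 1" q] by (metis compact_sphere empty_iff)
  define l where "l = q z"
  have nz: "norm z = 1" using z by simp
  then have zz: "z \<bullet> z = 1" by (simp add: dot_square_norm)
  have low: "l * (y \<bullet> y) \<le> q y" for y
  proof (cases "y = 0")
    case False
    have "l \<le> q ((1 / norm y) *\<^sub>R y)" unfolding l_def by (rule z(2)) (use False in simp)
    also have "\<dots> = (1 / norm y)\<^sup>2 * q y"
      by (simp add: q_def matrix_vector_mult_scaleR power2_eq_square)
    also have "\<dots> = q y / (y \<bullet> y)"
      by (simp add: power_divide dot_square_norm)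
    finally show ?thesis using False by (simp add: pos_le_divide_eq)
  qed (simp add: q_def)
  have "A *v z = l *\<^sub>R z"
  proof (rule ccontr)
    assume ne: "A *v z \<noteq> l *\<^sub>R z"
    define v where "v = A *v z - l *\<^sub>R z"
    define V where "V = v \<bullet> v"
    define c where "c = q v - l * V"
    have V: "V > 0" using ne by (simp add: V_def v_def)
    have c: "c \<ge> 0" using low[of v] by (simp add: c_def V_def)
    have zv: "z \<bullet> (A *v v) - l * (z \<bullet> v) = V"
    proof -
      have "V = (A *v z) \<bullet> v - l * (z \<bullet> v)" by (simp add: V_def v_def inner_diff_left)
      then show ?thesis by (simp only: sym)
    qed
    have vz: "v \<bullet> (A *v z) - l * (z \<bullet> v) = V"
      using zv sym[of z v] by (metis inner_commute)
    have exp: "q (z + s *\<^sub>R v) - l * ((z + s *\<^sub>R v) \<bullet> (z + s *\<^sub>R v)) = 2 * s * V + s\<^sup>2 * c" for s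
    proof -
      have "q (z + s *\<^sub>R v) = q z + s * (z \<bullet> (A *v v)) + s * (v \<bullet> (A *v z)) + s\<^sup>2 * q v"
        by (simp add: q_def matrix_vector_right_distrib matrix_vector_mult_scaleR inner_add_left inner_add_right
            algebra_simps power2_eq_square)
      moreover have "(z + s *\<^sub>R v) \<bullet> (z + s *\<^sub>R v) = 1 + 2 * s * (z \<bullet> v) + s\<^sup>2 * V"
        by (simp add: inner_add_left inner_add_right zz V_def inner_commute algebra_simps power2_eq_square)
      ultimately have "q (z + s *\<^sub>R v) - l * ((z + s *\<^sub>R v) \<bullet> (z + s *\<^sub>R v))
          = s * (z \<bullet> (A *v v) - l * (z \<bullet> v)) + s * (v \<bullet> (A *v z) - l * (z \<bullet> v)) + s\<^sup>2 * c"
        by (simp add: c_def l_def algebra_simps)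
      then show ?thesis by (simp add: zv vz)
    qed
    have nonneg: "0 \<le> 2 * s * V + s\<^sup>2 * c" for s
      using low[of "z + s *\<^sub>R v"] exp[of s] by simp
    \<comment> \<open>The step length balances the linear gain \<open>2 * s * V\<close> against the quadratic loss; the increment \<open>1\<close> covers \<open>c = 0\<close>.\<close>
    define a where "a = V / (c + 1)"
    have a: "a > 0" and V_a: "V = a * (c + 1)" using V c by (auto simp: a_def)
    have "2 * (- a) * V + (- a)\<^sup>2 * c = - (a * V) - a\<^sup>2"
      unfolding V_a by (simp add: power2_eq_square algebra_simps)
    also have "\<dots> < 0" using mult_pos_pos[OF a V] zero_le_power2[of a] by linarith
    finally show False using nonneg[of "- a"] by simp
  qed
  moreover have "z \<noteq> 0" using nz by auto
  moreover have "l \<le> s" if "A *v y = s *\<^sub>R y" "y \<noteq> 0" for s y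
    using low[of y] that by (simp add: q_def)
  ultimately have "sigma_min A = l"
    unfolding sigma_min_def by (intro Least_equality) blast+
  then show "\<exists>z. norm z = 1 \<and> sigma_min A = z \<bullet> (A *v z)" "sigma_min A * (y \<bullet> y) \<le> y \<bullet> (A *v y)"
    using nz low[of y] by (auto simp: l_def q_def)
qed

lemma convex_entropyD:
  assumes "convex_entropy \<Omega> U"
  shows convex_entropy_diff1: "\<And>w. w \<in> \<Omega> \<Longrightarrow> U differentiable (at w)"
    and convex_entropy_diff2: "\<And>w i. w \<in> \<Omega> \<Longrightarrow> partial i U differentiable (at w)"
    and convex_entropy_diff3: "\<And>w i j. w \<in> \<Omega> \<Longrightarrow> partial i (partial j U) differentiable (at w)"
    and convex_entropy_cont3: "\<And>i j l. continuous_on \<Omega> (partial i (partial j (partial l U)))"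
    and convex_entropy_pos: "\<And>w z. w \<in> \<Omega> \<Longrightarrow> z \<noteq> 0 \<Longrightarrow> 0 < z \<bullet> (hess U w *v z)"
  using assms by (auto simp: convex_entropy_def numeral_3_eq_3)

lemma convex_entropy_cont:
  assumes "convex_entropy \<Omega> U"
  shows convex_entropy_cont2: "continuous_on \<Omega> (partial i (partial j U))"
    and continuous_on_grad: "continuous_on \<Omega> (grad U)"
proof -
  note D = convex_entropyD[OF assms]
  have c: "\<And>i. continuous_on \<Omega> (partial i U)" and "continuous_on \<Omega> (partial i (partial j U))"
    using D(2,3) by (auto intro!: differentiable_imp_continuous_within continuous_at_imp_continuous_on)
  then show "continuous_on \<Omega> (partial i (partial j U))" by blast
  have "continuous_on \<Omega> (\<lambda>w. \<chi> i. partial i U w)"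
    by (intro continuous_on_vec_lambda c)
  then show "continuous_on \<Omega> (grad U)" by (simp add: grad_def[abs_def])
qed

lemma quadratic_form_expand:
  "z \<bullet> (hess U w *v y) = (\<Sum>i\<in>UNIV. \<Sum>j\<in>UNIV. z $ i * y $ j * partial i (partial j U) w)"
  by (simp add: inner_vec_def matrix_vector_mult_def hess_def sum_distrib_left mult_ac)

text \<open>Symmetry is what ties the least eigenvalue of the Hessian to its quadratic form.\<close>

lemma hess_symmetric:
  assumes "open \<Omega>" "convex_entropy \<Omega> U" "w \<in> \<Omega>"
  shows "x \<bullet> (hess U w *v y) = (hess U w *v x) \<bullet> y"
proof -
  have c: "partial i (partial j U) w = partial j (partial i U) w" for i j
    using second_partials_commute[OF assms(1,3)] convex_entropyD[OF assms(2)] convex_entropy_cont2[OF assms(2)]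
    by blast
  have "x \<bullet> (hess U w *v y) = (\<Sum>i\<in>UNIV. \<Sum>j\<in>UNIV. y $ j * x $ i * partial j (partial i U) w)"
    unfolding quadratic_form_expand by (intro sum.cong refl) (metis c mult.commute)
  also have "\<dots> = y \<bullet> (hess U w *v x)"
    unfolding quadratic_form_expand by (rule sum.swap)
  finally show ?thesis by (simp add: inner_commute)
qed

text \<open>Pointwise positivity of the Hessian does not bound the infimum away from zero; compactness of the states
  together with the unit sphere does.\<close>

lemma min_sigma_bounds:
  assumes \<Omega>: "open \<Omega>" and U: "convex_entropy \<Omega> U" and K: "compact K" "K \<subseteq> \<Omega>" "K \<noteq> {}"
  shows min_sigma_pos: "0 < min_sigma U K"
    and min_sigma_le_quadratic: "\<And>w z. w \<in> K \<Longrightarrow> min_sigma U K * (z \<bullet> z) \<le> z \<bullet> (hess U w *v z)"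
proof -
  define q where "q = (\<lambda>(w, z). z \<bullet> (hess U w *v z))"
  let ?S = "sphere (0 :: real ^ 'a) 1"
  have "continuous_on (K \<times> ?S) (\<lambda>p. partial i (partial j U) (fst p))" for i j
    by (rule continuous_on_compose2[OF convex_entropy_cont2[OF U]]) (use K in \<open>auto intro!: continuous_intros\<close>)
  then have "continuous_on (K \<times> ?S) q"
    unfolding q_def case_prod_beta quadratic_form_expand by (intro continuous_intros)
  moreover have "axis undefined 1 \<in> ?S" by simp
  then have "K \<times> ?S \<noteq> {}" using K by blast
  ultimately obtain p where p: "p \<in> K \<times> ?S" "\<And>r. r \<in> K \<times> ?S \<Longrightarrow> q p \<le> q r"
    using continuous_attains_inf[of "K \<times> ?S" q] K by (metis compact_Times compact_sphere)
  obtain w z where wz: "p = (w, z)" by (cases p)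
  have "z \<noteq> 0" using p(1) by (auto simp: wz)
  then have qp: "q p > 0"
    using p(1) K(2) convex_entropy_pos[OF U, of w z] by (auto simp: q_def wz)
  have low: "q p \<le> sigma_min (hess U w)" if "w \<in> K" for w
  proof -
    have "w \<in> \<Omega>" using K(2) that by blast
    then obtain z where z: "norm z = 1" "sigma_min (hess U w) = z \<bullet> (hess U w *v z)"
      using sigma_min_attained[OF hess_symmetric[OF \<Omega> U]] by blast
    then show ?thesis using p(2)[of "(w, z)"] that by (simp add: q_def)
  qed
  have "q p \<le> min_sigma U K"
    unfolding min_sigma_def by (rule cINF_greatest) (use K low in force)+
  then show "0 < min_sigma U K" using qp by simp
  show "min_sigma U K * (z \<bullet> z) \<le> z \<bullet> (hess U w *v z)" if w: "w \<in> K" for w z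
  proof -
    have "min_sigma U K \<le> \<bar>sigma_min (hess U w)\<bar>"
      unfolding min_sigma_def by (rule cINF_lower) (auto intro!: bdd_belowI[of _ 0] w)
    then have "min_sigma U K \<le> sigma_min (hess U w)" using low[OF w] qp by simp
    then have "min_sigma U K * (z \<bullet> z) \<le> sigma_min (hess U w) * (z \<bullet> z)"
      by (rule mult_right_mono) simp
    also have "\<dots> \<le> z \<bullet> (hess U w *v z)"
      using K w by (intro sigma_min_le_quadratic hess_symmetric[OF \<Omega> U]) blast
    finally show ?thesis .
  qed
qed

text \<open>The mean value theorem along the segment from \<open>c\<close> to \<open>w\<close>, which convexity keeps inside
  \<open>K\<close>.\<close>

lemma grad_strongly_monotone:
  assumes \<Omega>: "open \<Omega>" and U: "convex_entropy \<Omega> U" and K: "compact K" "K \<subseteq> \<Omega>" "convex K"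
    and c: "c \<in> K" "w \<in> K"
  shows "min_sigma U K * (norm (w - c))\<^sup>2 \<le> (w - c) \<bullet> (grad U w - grad U c)"
proof -
  define z where "z = w - c"
  have seg: "c + s *\<^sub>R z \<in> K" if "0 \<le> s" "s \<le> 1" for s
  proof -
    have "(1 - s) *\<^sub>R c + s *\<^sub>R w \<in> K" using K(3) c that by (simp add: convex_alt)
    then show ?thesis by (simp add: z_def algebra_simps)
  qed
  have "((\<lambda>s. \<Sum>j\<in>UNIV. z $ j * partial j U (c + s *\<^sub>R z)) has_real_derivative z \<bullet> (hess U (c + s *\<^sub>R z) *v z)) (at s)"
    if "0 \<le> s" "s \<le> 1" for s
  proof -
    have "((\<lambda>s. \<Sum>j\<in>UNIV. z $ j * partial j U (c + s *\<^sub>R z)) has_real_derivative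
        (\<Sum>j\<in>UNIV. z $ j * (\<Sum>i\<in>UNIV. z $ i * partial i (partial j U) (c + s *\<^sub>R z)))) (at s)"
      by (intro DERIV_sum DERIV_cmult has_real_derivative_line convex_entropy_diff2[OF U])
        (use seg[OF that] K in blast)
    moreover have "(\<Sum>j\<in>UNIV. z $ j * (\<Sum>i\<in>UNIV. z $ i * partial i (partial j U) (c + s *\<^sub>R z)))
        = z \<bullet> (hess U (c + s *\<^sub>R z) *v z)"
      unfolding quadratic_form_expand by (subst sum.swap) (simp add: sum_distrib_left mult_ac)
    ultimately show ?thesis by simp
  qed
  then obtain s where s: "0 < s" "s < 1"
    "(\<Sum>j\<in>UNIV. z $ j * partial j U (c + 1 *\<^sub>R z)) - (\<Sum>j\<in>UNIV. z $ j * partial j U (c + 0 *\<^sub>R z))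
      = (1 - 0) * (z \<bullet> (hess U (c + s *\<^sub>R z) *v z))"
    using MVT2[of 0 1 "\<lambda>s. \<Sum>j\<in>UNIV. z $ j * partial j U (c + s *\<^sub>R z)" "\<lambda>s. z \<bullet> (hess U (c + s *\<^sub>R z) *v z)"]
    by auto
  have "z \<bullet> (grad U w - grad U c) = z \<bullet> (hess U (c + s *\<^sub>R z) *v z)"
    using s(3) by (simp add: z_def grad_def inner_vec_def right_diff_distrib sum_subtractf)
  moreover have "min_sigma U K * (z \<bullet> z) \<le> z \<bullet> (hess U (c + s *\<^sub>R z) *v z)"
    using min_sigma_le_quadratic[OF \<Omega> U K(1,2)] seg[of s] s by auto
  ultimately show ?thesis by (simp add: z_def dot_square_norm)
qed

text \<open>Continuity on a compact set makes the set of values bounded; without that the supremum would carry no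
  information.\<close>

lemma abs_third_partial_le_max_d3:
  assumes U: "convex_entropy \<Omega> U" and K: "compact K" "K \<subseteq> \<Omega>" and w: "w \<in> K"
  shows "\<bar>partial i (partial j (partial l U)) w\<bar> \<le> max_d3 U K"
proof -
  let ?f = "\<lambda>(w, i, j, l). \<bar>partial i (partial j (partial l U)) w\<bar>"
  have "bdd_above ((\<lambda>w. \<bar>partial i (partial j (partial l U)) w\<bar>) ` K)" for i j l
  proof -
    have "continuous_on K (\<lambda>w. \<bar>partial i (partial j (partial l U)) w\<bar>)"
      using continuous_on_subset[OF convex_entropy_cont3[OF U] K(2)] by (intro continuous_intros)
    then show ?thesis
      by (intro bounded_imp_bdd_above compact_imp_bounded compact_continuous_image K(1))
  qed
  then have "bdd_above (\<Union>(i, j, l)\<in>UNIV. (\<lambda>w. \<bar>partial i (partial j (partial l U)) w\<bar>) ` K)"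
    by (subst bdd_above_UN) auto
  moreover have "?f ` (K \<times> UNIV \<times> UNIV \<times> UNIV) \<subseteq> (\<Union>(i, j, l)\<in>UNIV. (\<lambda>w. \<bar>partial i (partial j (partial l U)) w\<bar>) ` K)"
    by auto
  ultimately have bdd: "bdd_above (?f ` (K \<times> UNIV \<times> UNIV \<times> UNIV))"
    by (rule bdd_above_mono)
  show ?thesis
    unfolding max_d3_def using cSUP_upper[OF _ bdd, of "(w, i, j, l)"] w by simp
qed

text \<open>Each component of the remainder of the first-order expansion of the entropy variables is a quadratic form
  in the increment whose coefficients are third derivatives on the segment; Cauchy's inequality on
  the \<open>\<ell>\<^sup>1\<close>-norm of the increment costs a factor \<open>m\<close>, and taking the Euclidean norm over the
  components another \<open>sqrt m\<close>.\<close>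

lemma grad_taylor:
  fixes U :: "real ^ 'm::finite \<Rightarrow> real"
  assumes U: "convex_entropy \<Omega> U" and K: "compact K" "K \<subseteq> \<Omega>" "convex K"
    and c: "c \<in> K" "w \<in> K"
  shows "norm (grad U w - (\<chi> l. partial l U c + (\<Sum>i\<in>UNIV. (w - c) $ i * partial i (partial l U) c)))
    \<le> real CARD('m) powr (3/2) / 2 * max_d3 U K * (norm (w - c))\<^sup>2"
proof -
  define z where "z = w - c"
  define M where "M = max_d3 U K"
  define m where "m = real CARD('m)"
  have M0: "M \<ge> 0"
    using abs_third_partial_le_max_d3[OF U K(1,2) c(1)] unfolding M_def
    by (meson abs_ge_zero order_trans)
  have seg: "c + s *\<^sub>R z \<in> K" if "0 \<le> s" "s \<le> 1" for s
  proof -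
    have "(1 - s) *\<^sub>R c + s *\<^sub>R w \<in> K" using K(3) c that by (simp add: convex_alt)
    then show ?thesis by (simp add: z_def algebra_simps)
  qed
  have comp: "\<bar>partial l U w - (partial l U c + (\<Sum>i\<in>UNIV. z $ i * partial i (partial l U) c))\<bar> \<le> M / 2 * (m * (norm z)\<^sup>2)" for l
  proof -
    define g where "g = (\<lambda>s. partial l U (c + s *\<^sub>R z))"
    define g1 where "g1 = (\<lambda>s. \<Sum>i\<in>UNIV. z $ i * partial i (partial l U) (c + s *\<^sub>R z))"
    define g2 where "g2 = (\<lambda>s. \<Sum>i\<in>UNIV. z $ i * (\<Sum>j\<in>UNIV. z $ j * partial j (partial i (partial l U)) (c + s *\<^sub>R z)))"
    have d1: "(g has_real_derivative g1 s) (at s)" if "0 \<le> s" "s \<le> 1" for s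
      unfolding g_def g1_def
      by (intro has_real_derivative_line convex_entropy_diff2[OF U]) (use seg[OF that] K in blast)
    have d2: "(g1 has_real_derivative g2 s) (at s)" if "0 \<le> s" "s \<le> 1" for s
      unfolding g1_def g2_def
      by (intro DERIV_sum DERIV_cmult has_real_derivative_line convex_entropy_diff3[OF U]) (use seg[OF that] K in blast)
    define D where "D = (\<lambda>n::nat. if n = 0 then g else if n = 1 then g1 else g2)"
    have "\<exists>t. 0 < t \<and> t < 1 \<and> g 1 = (\<Sum>n<2. D n 0 / fact n * 1 ^ n) + D 2 t / fact 2 * 1 ^ 2"
      by (rule Maclaurin) (use d1 d2 in \<open>auto simp: D_def less_2_cases_iff\<close>)
    then obtain t where t: "0 < t" "t < 1" "g 1 = g 0 + g1 0 + g2 t / 2"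
      by (auto simp: D_def numeral_2_eq_2)
    have "\<bar>g2 t\<bar> \<le> (\<Sum>i\<in>UNIV. \<bar>z $ i\<bar> * (\<Sum>j\<in>UNIV. \<bar>z $ j\<bar> * M))"
    proof -
      have in_K: "c + t *\<^sub>R z \<in> K" using seg t by simp
      have "\<bar>\<Sum>j\<in>UNIV. z $ j * partial j (partial i (partial l U)) (c + t *\<^sub>R z)\<bar> \<le> (\<Sum>j\<in>UNIV. \<bar>z $ j\<bar> * M)" for i
        by (rule order_trans[OF sum_abs], unfold abs_mult M_def)
          (intro sum_mono mult_left_mono abs_third_partial_le_max_d3[OF U K(1,2) in_K] abs_ge_zero)
      then show ?thesis
        unfolding g2_def by (intro order_trans[OF sum_abs], unfold abs_mult) (intro sum_mono mult_left_mono abs_ge_zero)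
    qed
    also have "\<dots> = M * (\<Sum>i\<in>UNIV. \<bar>z $ i\<bar>)\<^sup>2"
      unfolding sum_distrib_right[symmetric] power2_eq_square by (simp add: mult_ac)
    also have "\<dots> \<le> M * (m * (norm z)\<^sup>2)"
    proof (rule mult_left_mono[OF _ M0])
      have "(\<Sum>i\<in>UNIV. \<bar>z $ i\<bar>)\<^sup>2 \<le> (\<Sum>i\<in>UNIV. \<bar>z $ i\<bar>\<^sup>2) * card (UNIV :: 'm set)"
        by (rule sum_squared_le_sum_of_squares)
      also have "(\<Sum>i\<in>UNIV. \<bar>z $ i\<bar>\<^sup>2) = (norm z)\<^sup>2"
        by (simp add: norm_vec_def L2_set_def sum_nonneg)
      finally show "(\<Sum>i\<in>UNIV. \<bar>z $ i\<bar>)\<^sup>2 \<le> m * (norm z)\<^sup>2" by (simp add: m_def mult.commute)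
    qed
    finally have "\<bar>g2 t\<bar> / 2 \<le> M / 2 * (m * (norm z)\<^sup>2)" by simp
    moreover have "g 1 - (g 0 + g1 0) = g2 t / 2" using t by simp
    ultimately have "\<bar>g 1 - (g 0 + g1 0)\<bar> \<le> M / 2 * (m * (norm z)\<^sup>2)" by linarith
    then show ?thesis by (simp add: g_def g1_def z_def)
  qed
  define v where "v = grad U w - (\<chi> l. partial l U c + (\<Sum>i\<in>UNIV. (w - c) $ i * partial i (partial l U) c))"
  have "\<bar>v $ l\<bar> \<le> M / 2 * (m * (norm z)\<^sup>2)" for l
    using comp[of l] by (simp add: v_def grad_def z_def)
  then have "norm v \<le> L2_set (\<lambda>l::'m. M / 2 * (m * (norm z)\<^sup>2)) UNIV"
    by (subst norm_vec_def) (intro L2_set_mono, auto)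
  also have "\<dots> = sqrt m * (M / 2 * (m * (norm z)\<^sup>2))"
    by (subst L2_set_constant) (use M0 in \<open>auto simp: m_def\<close>)
  also have "\<dots> = m powr (3/2) / 2 * M * (norm z)\<^sup>2"
  proof -
    have "m > 0" by (simp add: m_def)
    then have "m powr (3/2) = m powr (1 + 1/2)" by simp
    also have "\<dots> = m * sqrt m" using \<open>m > 0\<close> by (simp only: powr_add powr_half_sqrt) simp
    finally show ?thesis by simp
  qed
  finally show ?thesis by (simp add: v_def z_def m_def M_def)
qed

section \<open>Polynomials on an interval\<close>

definition poly_inner :: "real \<Rightarrow> real \<Rightarrow> real poly \<Rightarrow> real poly \<Rightarrow> real" where
  "poly_inner a b p q = integral {a..b} (\<lambda>y. poly p y * poly q y)"

lemma continuous_on_poly [continuous_intros]: "continuous_on S (poly (p :: real poly))"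
  by (intro continuous_at_imp_continuous_on ballI poly_isCont)

lemma poly_inner_add_left: "poly_inner a b (p + q) r = poly_inner a b p r + poly_inner a b q r"
  unfolding poly_inner_def poly_add distrib_right
  by (intro integral_add integrable_continuous_real continuous_intros)

lemma poly_inner_diff_left: "poly_inner a b (p - q) r = poly_inner a b p r - poly_inner a b q r"
  unfolding poly_inner_def poly_diff left_diff_distrib
  by (intro integral_diff integrable_continuous_real continuous_intros)

lemma poly_inner_smult_left: "poly_inner a b (smult c p) r = c * poly_inner a b p r"
  by (simp add: poly_inner_def mult.assoc)

lemma poly_inner_commute: "poly_inner a b p q = poly_inner a b q p"
  by (simp add: poly_inner_def mult.commute)

lemma poly_inner_smult_right: "poly_inner a b p (smult c r) = c * poly_inner a b p r"
  by (metis poly_inner_commute poly_inner_smult_left)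

lemma poly_inner_sum_left: "poly_inner a b (\<Sum>i\<in>I. f i) r = (\<Sum>i\<in>I. poly_inner a b (f i) r)"
proof (induction I rule: infinite_finite_induct)
  case (insert i I)
  then show ?case by (simp add: poly_inner_add_left)
qed (simp_all add: poly_inner_def)

lemma poly_inner_sum_right: "poly_inner a b r (\<Sum>i\<in>I. f i) = (\<Sum>i\<in>I. poly_inner a b r (f i))"
  unfolding poly_inner_commute[of a b r] by (rule poly_inner_sum_left)

lemma poly_inner_self_pos:
  assumes "a < b" "p \<noteq> 0"
  shows "0 < poly_inner a b p p"
proof -
  have "poly_inner a b p p \<noteq> 0"
  proof
    assume "poly_inner a b p p = 0"
    then have "\<forall>y\<in>{a..b}. poly p y * poly p y = 0"
      unfolding poly_inner_def using assms by (subst (asm) integral_eq_0_iff) (auto intro!: continuous_intros)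
    then have "{a..b} \<subseteq> {y. poly p y = 0}" by auto
    then have "finite {a..b}" using poly_roots_finite[OF assms(2)] finite_subset by blast
    then show False using assms(1) infinite_Icc by blast
  qed
  moreover have "0 \<le> poly_inner a b p p"
    unfolding poly_inner_def by (intro integral_nonneg integrable_continuous_real continuous_intros) simp
  ultimately show ?thesis by simp
qed

text \<open>Completeness is expressed by the Fourier expansion, the form in which the basis is applied below.\<close>

definition orthonormal_basis :: "real \<Rightarrow> real \<Rightarrow> nat \<Rightarrow> (nat \<Rightarrow> real poly) \<Rightarrow> bool" where
  "orthonormal_basis a b n e \<longleftrightarrow>
    (\<forall>i<n. degree (e i) < n) \<and>
    (\<forall>i<n. \<forall>j<n. poly_inner a b (e i) (e j) = (if i = j then 1 else 0)) \<and>
    (\<forall>p. degree p < n \<longrightarrow> p = (\<Sum>i<n. smult (poly_inner a b p (e i)) (e i)))"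

text \<open>Gram--Schmidt orthonormalisation of the monomials.\<close>

lemma ex_orthonormal_basis:
  assumes "a < b"
  shows "\<exists>e. orthonormal_basis a b n e"
proof (induction n)
  case 0
  then show ?case by (simp add: orthonormal_basis_def)
next
  case (Suc n)
  then obtain e where deg: "\<And>i. i < n \<Longrightarrow> degree (e i) < n"
    and on: "\<And>i j. i < n \<Longrightarrow> j < n \<Longrightarrow> poly_inner a b (e i) (e j) = (if i = j then 1 else 0)"
    and span: "\<And>p. degree p < n \<Longrightarrow> p = (\<Sum>i<n. smult (poly_inner a b p (e i)) (e i))"
    unfolding orthonormal_basis_def by blast
  define q where "q = monom 1 n - (\<Sum>i<n. smult (poly_inner a b (monom 1 n) (e i)) (e i))"
  have "coeff q n = 1"
    by (simp add: q_def coeff_sum coeff_eq_0[OF deg])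
  then have q0: "q \<noteq> 0" by auto
  have degq: "degree q \<le> n"
    unfolding q_def
    by (intro degree_diff_le degree_monom_le degree_sum_le) (auto intro: order_trans[OF degree_smult_le] less_imp_le deg)
  have qe: "poly_inner a b q (e j) = 0" if "j < n" for j
    using that by (simp add: q_def poly_inner_diff_left poly_inner_sum_left poly_inner_smult_left on if_distrib cong: if_cong)
  define Q where "Q = poly_inner a b q q"
  have Q: "Q > 0" unfolding Q_def by (rule poly_inner_self_pos[OF assms q0])
  define e' where "e' = e(n := smult (1 / sqrt Q) q)"
  have on': "poly_inner a b (e' i) (e' j) = (if i = j then 1 else 0)" if "i < Suc n" "j < Suc n" for i j
  proof -
    consider "i < n" "j < n" | "i < n" "j = n" | "i = n" "j < n" | "i = n" "j = n" using \<open>i < Suc n\<close> \<open>j < Suc n\<close> by linarith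
    then show ?thesis
    proof cases
      case 4
      have "(1 / sqrt Q) * ((1 / sqrt Q) * Q) = 1" using Q by (simp add: real_div_sqrt)
      then show ?thesis using 4 by (simp add: e'_def poly_inner_smult_left poly_inner_smult_right Q_def)
    qed (auto simp: e'_def on qe poly_inner_smult_left poly_inner_smult_right poly_inner_commute[of a b "e i"])
  qed
  have comb: "\<exists>d. p = (\<Sum>i<Suc n. smult (d i) (e' i))" if "degree p < Suc n" for p
  proof -
    define r where "r = p - smult (coeff p n) q"
    have "coeff r n = 0" using \<open>coeff q n = 1\<close> by (simp add: r_def)
    moreover have "degree r \<le> n"
      unfolding r_def using that by (intro degree_diff_le order_trans[OF degree_smult_le degq]) auto
    ultimately have "r = 0 \<or> degree r < n"
      by (metis le_neq_implies_less leading_coeff_0_iff)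
    then obtain d where d: "r = (\<Sum>i<n. smult (d i) (e i))"
    proof
      assume "r = 0"
      then show ?thesis using that[of "\<lambda>_. 0"] by simp
    next
      assume "degree r < n"
      then show ?thesis by (rule that[OF span])
    qed
    have "p = r + smult (coeff p n) q" by (simp add: r_def)
    also have "smult (coeff p n) q = smult (coeff p n * sqrt Q) (e' n)" using Q by (simp add: e'_def)
    also have "r = (\<Sum>i<n. smult (d i) (e' i))" unfolding d e'_def by (intro sum.cong) auto
    finally show ?thesis
      by (intro exI[of _ "d(n := coeff p n * sqrt Q)"]) simp
  qed
  have "p = (\<Sum>i<Suc n. smult (poly_inner a b p (e' i)) (e' i))" if degp: "degree p < Suc n" for p
  proof -
    obtain d where d: "p = (\<Sum>i<Suc n. smult (d i) (e' i))" using comb[OF degp] by blast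
    have "poly_inner a b p (e' j) = d j" if "j < Suc n" for j
    proof -
      have "poly_inner a b p (e' j) = (\<Sum>i<Suc n. d i * (if i = j then 1 else 0))"
        unfolding d poly_inner_sum_left poly_inner_smult_left by (intro sum.cong refl) (use on' that in auto)
      also have "\<dots> = d j" using that by (simp add: if_distrib[of "\<lambda>c. _ * c"] cong: if_cong del: sum.lessThan_Suc)
      finally show ?thesis .
    qed
    then have "(\<Sum>i<Suc n. smult (poly_inner a b p (e' i)) (e' i)) = (\<Sum>i<Suc n. smult (d i) (e' i))"
      by (intro sum.cong) auto
    then show ?thesis using d by simp
  qed
  moreover have "degree (e' i) < Suc n" if "i < Suc n" for i
  proof (cases "i = n")
    case True
    then show ?thesis using degq Q by (simp add: e'_def less_Suc_eq_le)
  next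
    case False
    then show ?thesis using that deg[of i] by (simp add: e'_def)
  qed
  ultimately show ?case unfolding orthonormal_basis_def using on' by blast
qed

text \<open>The Fourier sum of \<open>g\<close> in an orthonormal basis.\<close>

lemma ex_projection:
  fixes a b :: real and g :: "real \<Rightarrow> real"
  assumes ab: "a < b" and g: "continuous_on {a..b} g"
  shows "\<exists>q. degree q \<le> k \<and> (\<forall>r. degree r \<le> k \<longrightarrow> integral {a..b} (\<lambda>y. poly q y * poly r y) = integral {a..b} (\<lambda>y. g y * poly r y))"
proof -
  obtain e where deg: "\<And>i. i < Suc k \<Longrightarrow> degree (e i) < Suc k"
    and on: "\<And>i j. i < Suc k \<Longrightarrow> j < Suc k \<Longrightarrow> poly_inner a b (e i) (e j) = (if i = j then 1 else 0)"
    and span: "\<And>p. degree p < Suc k \<Longrightarrow> p = (\<Sum>i<Suc k. smult (poly_inner a b p (e i)) (e i))"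
    using ex_orthonormal_basis[OF ab, of "Suc k"] unfolding orthonormal_basis_def by blast
  define c where "c = (\<lambda>i. integral {a..b} (\<lambda>y. g y * poly (e i) y))"
  define q where "q = (\<Sum>i<Suc k. smult (c i) (e i))"
  have "poly_inner a b q r = integral {a..b} (\<lambda>y. g y * poly r y)" if "degree r \<le> k" for r
  proof -
    define d where "d = (\<lambda>i. poly_inner a b r (e i))"
    have r: "r = (\<Sum>i<Suc k. smult (d i) (e i))" unfolding d_def by (rule span) (use that in simp)
    have "poly_inner a b q r = (\<Sum>i<Suc k. c i * d i)"
      by (simp only: q_def poly_inner_sum_left poly_inner_smult_left d_def poly_inner_commute[of a b r])
    also have "\<dots> = (\<Sum>i<Suc k. integral {a..b} (\<lambda>y. d i * (g y * poly (e i) y)))"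
      by (simp only: c_def integral_mult_right mult.commute)
    also have "\<dots> = integral {a..b} (\<lambda>y. \<Sum>i<Suc k. d i * (g y * poly (e i) y))"
      by (intro integral_sum[symmetric] integrable_continuous_real continuous_intros g finite_lessThan)
    also have "\<dots> = integral {a..b} (\<lambda>y. g y * poly r y)"
    proof (intro integral_cong)
      fix y
      have "poly r y = (\<Sum>i<Suc k. d i * poly (e i) y)"
        by (subst r) (simp only: poly_sum poly_smult)
      then show "(\<Sum>i<Suc k. d i * (g y * poly (e i) y)) = g y * poly r y"
        by (simp only: sum_distrib_left mult.left_commute)
    qed
    finally show ?thesis .
  qed
  moreover have "degree q \<le> k"
    unfolding q_def by (intro degree_sum_le) (auto intro!: order_trans[OF degree_smult_le] dest: deg)
  ultimately show ?thesis unfolding poly_inner_def by blast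
qed

lemma projection_unique:
  fixes a b :: real and p q :: "real poly"
  assumes ab: "a < b" and deg: "degree p \<le> k" "degree q \<le> k"
    and eq: "\<And>r. degree r \<le> k \<Longrightarrow> integral {a..b} (\<lambda>y. poly p y * poly r y) = integral {a..b} (\<lambda>y. poly q y * poly r y)"
  shows "p = q"
proof (rule ccontr)
  assume "p \<noteq> q"
  then have "0 < poly_inner a b (p - q) (p - q)" using poly_inner_self_pos[OF ab] by simp
  also have "\<dots> = 0"
    using eq[of "p - q"] deg by (simp add: poly_inner_diff_left degree_diff_le) (simp add: poly_inner_def)
  finally show False by simp
qed

text \<open>On the unit interval the values of a polynomial are controlled by its coefficients in an orthonormal basis;
  an affine change of variables transports this to any interval.\<close>

lemma poly_sup_le_L2:
  obtains B where "B \<ge> 1"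
    "\<And>(a :: real) b p y. a < b \<Longrightarrow> degree p \<le> k \<Longrightarrow> y \<in> {a..b} \<Longrightarrow>
      (poly p y)\<^sup>2 \<le> B / (b - a) * integral {a..b} (\<lambda>y. (poly p y)\<^sup>2)"
proof -
  obtain e where on: "\<And>i j. i < Suc k \<Longrightarrow> j < Suc k \<Longrightarrow> poly_inner 0 1 (e i) (e j) = (if i = j then 1 else 0)"
    and span: "\<And>p. degree p < Suc k \<Longrightarrow> p = (\<Sum>i<Suc k. smult (poly_inner 0 1 p (e i)) (e i))"
    using ex_orthonormal_basis[of 0 1 "Suc k"] unfolding orthonormal_basis_def by auto
  have "continuous_on {0..1} (\<lambda>y. \<Sum>i<Suc k. (poly (e i) y)\<^sup>2)" by (intro continuous_intros)
  then have "bdd_above ((\<lambda>y. \<Sum>i<Suc k. (poly (e i) y)\<^sup>2) ` {0..1::real})"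
    by (intro bounded_imp_bdd_above compact_imp_bounded compact_continuous_image compact_Icc)
  then obtain B0 where "\<forall>v\<in>(\<lambda>y. \<Sum>i<Suc k. (poly (e i) y)\<^sup>2) ` {0..1::real}. v \<le> B0"
    unfolding bdd_above_def by blast
  then have B0: "(\<Sum>i<Suc k. (poly (e i) y)\<^sup>2) \<le> B0" if "y \<in> {0..1}" for y
    using that by blast
  define B where "B = max 1 B0"
  have unit: "(poly P y)\<^sup>2 \<le> B * poly_inner 0 1 P P" if "degree P \<le> k" "y \<in> {0..1}" for P y
  proof -
    define d where "d = (\<lambda>i. poly_inner 0 1 P (e i))"
    have P: "P = (\<Sum>i<Suc k. smult (d i) (e i))" unfolding d_def by (rule span) (use that in simp)
    have "(poly P y)\<^sup>2 = (\<Sum>i<Suc k. d i * poly (e i) y)\<^sup>2"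
      by (subst P) (simp only: poly_sum poly_smult)
    also have "\<dots> \<le> (\<Sum>i<Suc k. (d i)\<^sup>2) * (\<Sum>i<Suc k. (poly (e i) y)\<^sup>2)"
      by (rule Cauchy_Schwarz_ineq_sum)
    also have "\<dots> \<le> (\<Sum>i<Suc k. (d i)\<^sup>2) * B"
      using B0[OF that(2)] by (intro mult_left_mono sum_nonneg) (auto simp: B_def simp del: sum.lessThan_Suc)
    also have "(\<Sum>i<Suc k. (d i)\<^sup>2) = poly_inner 0 1 P P"
    proof -
      have "poly_inner 0 1 P (\<Sum>i<Suc k. smult (d i) (e i)) = (\<Sum>i<Suc k. (d i)\<^sup>2)"
        by (simp only: poly_inner_sum_right poly_inner_smult_right d_def power2_eq_square)
      then show ?thesis using P by simp
    qed
    finally show ?thesis by (simp add: mult.commute)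
  qed
  have "(poly p y)\<^sup>2 \<le> B / (b - a) * integral {a..b} (\<lambda>y. (poly p y)\<^sup>2)"
    if ab: "a < b" and p: "degree p \<le> k" and y: "y \<in> {a..b}" for a b y :: real and p
  proof -
    define h where "h = b - a"
    have h: "h > 0" using ab by (simp add: h_def)
    define P where "P = pcompose p [:a, h:]"
    have Pp: "poly P s = poly p (h * s + a)" for s by (simp add: P_def poly_pcompose add.commute mult.commute)
    have "degree P \<le> k" using degree_pcompose_le[of p "[:a, h:]"] p by (simp add: P_def split: if_splits)
    moreover have "(y - a) / h \<in> {0..1}" using y h by (simp add: h_def)
    ultimately have "(poly P ((y - a) / h))\<^sup>2 \<le> B * poly_inner 0 1 P P" by (rule unit)
    moreover have "poly P ((y - a) / h) = poly p y" using h by (simp add: Pp)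
    moreover have "poly_inner 0 1 P P = integral {a..b} (\<lambda>y. (poly p y)\<^sup>2) / h"
    proof -
      have "((\<lambda>y. (poly p y)\<^sup>2) has_integral integral {a..b} (\<lambda>y. (poly p y)\<^sup>2)) (cbox a b)"
        unfolding cbox_interval by (intro integrable_integral integrable_continuous_real continuous_intros)
      from has_integral_affinity'[OF this h, of a]
      have "((\<lambda>s. (poly P s)\<^sup>2) has_integral integral {a..b} (\<lambda>y. (poly p y)\<^sup>2) / h) {0..1}"
        using h by (simp add: Pp h_def[symmetric] divide_inverse mult.commute)
      then show ?thesis by (simp add: poly_inner_def power2_eq_square integral_unique)
    qed
    ultimately show ?thesis by (simp add: h_def)
  qed
  then show ?thesis using that[of B] by (simp add: B_def)
qed

text \<open>An infimum of admissible constants is itself admissible, because the inequality is linear in the constant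
  after squaring; but this says something only if there is an admissible constant at all. One comes from bounding
  \<open>p ^ 4\<close> by \<open>p\<^sup>2\<close> times the square of the maximum of \<open>p\<close>.\<close>

lemma Ck_const_inverse_inequality:
  fixes a b :: real and p :: "real poly"
  shows Ck_const_nonneg: "0 \<le> Ck_const k"
    and L4_le_L2_poly: "a < b \<Longrightarrow> degree p \<le> k \<Longrightarrow>
      sqrt (integral {a..b} (\<lambda>y. (poly p y) ^ 4)) \<le> Ck_const k / sqrt (b - a) * integral {a..b} (\<lambda>y. (poly p y)\<^sup>2)"
proof -
  define S where "S = {C. 0 < C \<and> (\<forall>a b p. a < b \<and> degree p \<le> k \<longrightarrow>
     L4_norm {a..b} (poly p) \<le> sqrt C * (b - a) powr (-1/4) * L2_norm {a..b} (poly p))}"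
  have L4: "L4_norm {a..b} (poly p) = root 4 (integral {a..b} (\<lambda>y. (poly p y) ^ 4))" for a b p
    by (simp add: L4_norm_def)
  have L2: "L2_norm {a..b} (poly p) = sqrt (integral {a..b} (\<lambda>y. (poly p y)\<^sup>2))" for a b p
    by (simp add: L2_norm_def)
  have I2: "0 \<le> integral {a..b} (\<lambda>y. (poly p y)\<^sup>2)" and I4: "0 \<le> integral {a..b} (\<lambda>y. (poly p y) ^ 4)" for a b :: real and p
    by (intro integral_nonneg integrable_continuous_real continuous_intros; simp)+
  obtain B where B: "B \<ge> 1" and sup: "\<And>(a :: real) b p y. a < b \<Longrightarrow> degree p \<le> k \<Longrightarrow> y \<in> {a..b} \<Longrightarrow>
      (poly p y)\<^sup>2 \<le> B / (b - a) * integral {a..b} (\<lambda>y. (poly p y)\<^sup>2)"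
    using poly_sup_le_L2 by blast
  have "B \<in> S"
    unfolding S_def
  proof (intro CollectI conjI allI impI)
    fix a b :: real and p :: "real poly" assume "a < b \<and> degree p \<le> k"
    then have ab: "a < b" and p: "degree p \<le> k" by auto
    define I where "I = integral {a..b} (\<lambda>y. (poly p y)\<^sup>2)"
    define h where "h = b - a"
    have h: "h > 0" using ab by (simp add: h_def)
    have I0: "I \<ge> 0" unfolding I_def by (rule I2)
    have "integral {a..b} (\<lambda>y. (poly p y) ^ 4) \<le> integral {a..b} (\<lambda>y. B / h * I * (poly p y)\<^sup>2)"
    proof (intro integral_le integrable_continuous_real continuous_intros)
      fix y assume "y \<in> {a..b}"
      then have "(poly p y)\<^sup>2 * (poly p y)\<^sup>2 \<le> B / h * I * (poly p y)\<^sup>2"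
        using sup[OF ab p] by (intro mult_right_mono) (auto simp: I_def h_def)
      then show "poly p y ^ 4 \<le> B / h * I * (poly p y)\<^sup>2"
        by (simp only: power_add[symmetric]) simp
    qed
    also have "\<dots> = B / h * I * I" unfolding I_def by (rule integral_mult_right)
    also have "\<dots> = B / h * I\<^sup>2" by (simp add: power2_eq_square)
    \<comment> \<open>Since \<open>B \<ge> 1\<close>, passing to \<open>B\<^sup>2\<close> avoids a square root in the witness.\<close>
    also have "\<dots> \<le> B\<^sup>2 / h * I\<^sup>2"
      using B h by (intro mult_right_mono divide_right_mono) (auto simp: power2_eq_square)
    also have "\<dots> = (sqrt B * h powr (-1/4) * sqrt I) ^ 4"
    proof -
      have "sqrt B ^ 4 = B\<^sup>2" "sqrt I ^ 4 = I\<^sup>2"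
        using B I0 power_mult[of "sqrt B" 2 2] power_mult[of "sqrt I" 2 2] by simp_all
      moreover have "(h powr (-1/4)) ^ 4 = 1 / h"
      proof -
        have "(h powr (-1/4)) ^ 4 = h powr ((-1/4) * real 4)"
          using h by (simp only: powr_realpow[symmetric] powr_powr powr_gt_zero)
        also have "\<dots> = 1 / h" using h by (simp add: powr_minus_divide)
        finally show ?thesis .
      qed
      ultimately show ?thesis by (simp add: power_mult_distrib)
    qed
    finally have "root 4 (integral {a..b} (\<lambda>y. (poly p y) ^ 4)) \<le> root 4 ((sqrt B * h powr (-1/4) * sqrt I) ^ 4)"
      by simp
    also have "\<dots> = sqrt B * h powr (-1/4) * sqrt I"
      using B I0 by (intro real_root_power_cancel) auto
    finally show "L4_norm {a..b} (poly p) \<le> sqrt B * (b - a) powr (-1/4) * L2_norm {a..b} (poly p)"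
      unfolding L4 L2 by (simp add: I_def h_def)
  qed (use B in simp)
  then have ne: "S \<noteq> {}" by blast
  have Ck: "Ck_const k = Inf S" by (simp add: Ck_const_def S_def)
  show "0 \<le> Ck_const k"
    unfolding Ck by (rule cInf_greatest[OF ne]) (simp add: S_def)
  show "sqrt (integral {a..b} (\<lambda>y. (poly p y) ^ 4)) \<le> Ck_const k / sqrt (b - a) * integral {a..b} (\<lambda>y. (poly p y)\<^sup>2)"
    if ab: "a < b" and p: "degree p \<le> k" for a b :: real and p
  proof -
    define I where "I = integral {a..b} (\<lambda>y. (poly p y)\<^sup>2)"
    define J where "J = integral {a..b} (\<lambda>y. (poly p y) ^ 4)"
    define h where "h = b - a"
    have h: "h > 0" using ab by (simp add: h_def)
    have I0: "I \<ge> 0" and J0: "J \<ge> 0" unfolding I_def J_def by (rule I2 I4)+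
    have each: "sqrt J \<le> C * (I / sqrt h)" if "C \<in> S" for C
    proof -
      have C: "C > 0" and "L4_norm {a..b} (poly p) \<le> sqrt C * h powr (-1/4) * L2_norm {a..b} (poly p)"
        using that ab p by (auto simp: S_def h_def)
      then have "root 4 J \<le> sqrt C * h powr (-1/4) * sqrt I"
        unfolding L4 L2 I_def J_def by simp
      then have "(root 4 J)\<^sup>2 \<le> (sqrt C * h powr (-1/4) * sqrt I)\<^sup>2"
        using J0 by (intro power_mono) auto
      moreover have "(root 4 J)\<^sup>2 = sqrt J"
      proof -
        have "root 4 J = root 2 (root 2 J)" using real_root_mult_exp[of 2 2 J] by simp
        then show ?thesis using J0 by (simp add: sqrt_def[symmetric])
      qed
      moreover have "(h powr (-1/4))\<^sup>2 = 1 / sqrt h"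
      proof -
        have "(h powr (-1/4))\<^sup>2 = h powr ((-1/4) * real 2)"
          using h by (simp only: powr_realpow[symmetric] powr_powr powr_gt_zero)
        also have "\<dots> = 1 / sqrt h" using h by (simp add: powr_minus_divide powr_half_sqrt)
        finally show ?thesis .
      qed
      ultimately show ?thesis using C I0 by (simp add: power_mult_distrib)
    qed
    show ?thesis
    proof (cases "I / sqrt h = 0")
      case True
      then have "I = 0" using h by simp
      then show ?thesis using each[OF \<open>B \<in> S\<close>] by (simp add: I_def[symmetric] J_def[symmetric])
    next
      case False
      then have pos: "I / sqrt h > 0" using I0 h by simp
      have "sqrt J / (I / sqrt h) \<le> Inf S"
        by (rule cInf_greatest[OF ne]) (use each pos in \<open>simp only: pos_divide_le_eq\<close>)
      then have "sqrt J \<le> Inf S * (I / sqrt h)" using pos by (simp only: pos_divide_le_eq)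
      then show ?thesis by (simp add: I_def J_def h_def Ck)
    qed
  qed
qed

text \<open>The integral of \<open>(G * f - A * g)\<^sup>2\<close> is \<open>G * (F * G - A\<^sup>2)\<close> and is nonnegative.\<close>

lemma integral_Cauchy_Schwarz:
  fixes f g :: "real \<Rightarrow> real"
  assumes ab: "a < b" and f: "continuous_on {a..b} f" and g: "continuous_on {a..b} g"
  shows "integral {a..b} (\<lambda>y. f y * g y) \<le> sqrt (integral {a..b} (\<lambda>y. (f y)\<^sup>2)) * sqrt (integral {a..b} (\<lambda>y. (g y)\<^sup>2))"
proof -
  define A where "A = integral {a..b} (\<lambda>y. f y * g y)"
  define F where "F = integral {a..b} (\<lambda>y. (f y)\<^sup>2)"
  define G where "G = integral {a..b} (\<lambda>y. (g y)\<^sup>2)"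
  have F0: "F \<ge> 0" and G0: "G \<ge> 0"
    unfolding F_def G_def by (intro integral_nonneg integrable_continuous_real continuous_intros f g; simp)+
  have "A\<^sup>2 \<le> F * G"
  proof (cases "G = 0")
    case True
    then have "\<forall>y\<in>{a..b}. (g y)\<^sup>2 = 0"
      unfolding G_def using ab by (subst (asm) integral_eq_0_iff) (auto intro!: continuous_intros g)
    then have "A = integral {a..b} (\<lambda>y. 0)" unfolding A_def by (intro integral_cong) auto
    then show ?thesis by (simp add: True)
  next
    case False
    have "0 \<le> integral {a..b} (\<lambda>y. (G * f y - A * g y)\<^sup>2)"
      by (intro integral_nonneg integrable_continuous_real continuous_intros f g) simp
    also have "(\<lambda>y. (G * f y - A * g y)\<^sup>2) = (\<lambda>y. G\<^sup>2 * (f y)\<^sup>2 - 2 * G * A * (f y * g y) + A\<^sup>2 * (g y)\<^sup>2)"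
      by (auto simp: power2_eq_square algebra_simps)
    also have "integral {a..b} \<dots> = G\<^sup>2 * F - 2 * G * A * A + A\<^sup>2 * G"
    proof -
      have "((\<lambda>y. G\<^sup>2 * (f y)\<^sup>2 - 2 * G * A * (f y * g y) + A\<^sup>2 * (g y)\<^sup>2) has_integral
          G\<^sup>2 * F - 2 * G * A * A + A\<^sup>2 * G) {a..b}"
        unfolding A_def F_def G_def
        by (intro has_integral_add has_integral_diff has_integral_mult_right integrable_integral
            integrable_continuous_real continuous_intros f g)
      then show ?thesis by (rule integral_unique)
    qed
    also have "\<dots> = G * (F * G - A\<^sup>2)" by (simp add: power2_eq_square algebra_simps)
    finally show ?thesis using G0 False by (simp add: zero_le_mult_iff)
  qed
  then have "A \<le> sqrt (F * G)" using real_le_rsqrt by blast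
  then show ?thesis by (simp add: A_def F_def G_def real_sqrt_mult)
qed

lemma integral_Cauchy_Schwarz_vec:
  fixes f g :: "real \<Rightarrow> real ^ 'm::finite"
  assumes ab: "a < b" and f: "continuous_on {a..b} f" and g: "continuous_on {a..b} g"
  shows "integral {a..b} (\<lambda>y. f y \<bullet> g y) \<le> L2_norm {a..b} f * L2_norm {a..b} g"
proof -
  have "integral {a..b} (\<lambda>y. f y \<bullet> g y) \<le> integral {a..b} (\<lambda>y. norm (f y) * norm (g y))"
    by (intro integral_le integrable_continuous_real continuous_intros f g norm_cauchy_schwarz)
  also have "\<dots> \<le> L2_norm {a..b} f * L2_norm {a..b} g"
    unfolding L2_norm_def by (intro integral_Cauchy_Schwarz ab continuous_intros f g)
  finally show ?thesis .
qed

text \<open>No constant depending on the dimension is lost: the fourth power of the norm expands into products of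
  squared components, the Cauchy--Schwarz inequality reduces each product to scalar inverse inequalities, and the
  resulting double sum factors into a square.\<close>

lemma L4_le_L2_vec:
  fixes z :: "real \<Rightarrow> real ^ 'm::finite"
  assumes ab: "a < b" and p: "\<And>i. degree (p i) \<le> k" "\<And>y i. z y $ i = poly (p i) y"
  shows "sqrt (integral {a..b} (\<lambda>y. norm (z y) ^ 4)) \<le> Ck_const k / sqrt (b - a) * integral {a..b} (\<lambda>y. (norm (z y))\<^sup>2)"
proof -
  define c where "c = Ck_const k / sqrt (b - a)"
  define Q where "Q = (\<lambda>i. integral {a..b} (\<lambda>y. (poly (p i) y)\<^sup>2))"
  have c: "c \<ge> 0" using Ck_const_nonneg ab by (simp add: c_def)
  have Q: "Q i \<ge> 0" for i
    unfolding Q_def by (intro integral_nonneg integrable_continuous_real continuous_intros) simp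
  have nz: "(norm (z y))\<^sup>2 = (\<Sum>i\<in>UNIV. (poly (p i) y)\<^sup>2)" for y
    by (simp add: norm_vec_def L2_set_def sum_nonneg p)
  have I2: "integral {a..b} (\<lambda>y. (norm (z y))\<^sup>2) = (\<Sum>i\<in>UNIV. Q i)"
    unfolding nz Q_def by (intro integral_sum integrable_continuous_real continuous_intros) simp
  have "norm (z y) ^ 4 = (\<Sum>i\<in>UNIV. \<Sum>j\<in>UNIV. (poly (p i) y)\<^sup>2 * (poly (p j) y)\<^sup>2)" for y
  proof -
    have "norm (z y) ^ 4 = (norm (z y))\<^sup>2 * (norm (z y))\<^sup>2" by (simp add: power_add[symmetric])
    then show ?thesis unfolding nz sum_product .
  qed
  then have "integral {a..b} (\<lambda>y. norm (z y) ^ 4) = (\<Sum>i\<in>UNIV. \<Sum>j\<in>UNIV. integral {a..b} (\<lambda>y. (poly (p i) y)\<^sup>2 * (poly (p j) y)\<^sup>2))"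
    by (simp add: integral_sum integrable_continuous_real continuous_intros)
  also have "\<dots> \<le> (\<Sum>i\<in>UNIV. \<Sum>j\<in>UNIV. (c * Q i) * (c * Q j))"
  proof (intro sum_mono)
    fix i j
    have "integral {a..b} (\<lambda>y. (poly (p i) y)\<^sup>2 * (poly (p j) y)\<^sup>2)
        \<le> sqrt (integral {a..b} (\<lambda>y. ((poly (p i) y)\<^sup>2)\<^sup>2)) * sqrt (integral {a..b} (\<lambda>y. ((poly (p j) y)\<^sup>2)\<^sup>2))"
      by (intro integral_Cauchy_Schwarz ab continuous_intros)
    also have "\<dots> \<le> (c * Q i) * (c * Q j)"
    proof -
      have b: "sqrt (integral {a..b} (\<lambda>y. ((poly (p l) y)\<^sup>2)\<^sup>2)) \<le> c * Q l" for l
        using L4_le_L2_poly[OF ab p(1)[of l]] by (simp add: c_def Q_def)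
      have nn: "0 \<le> c * Q i" using c Q by simp
      have "0 \<le> sqrt (integral {a..b} (\<lambda>y. ((poly (p j) y)\<^sup>2)\<^sup>2))"
        by (intro real_sqrt_ge_zero integral_nonneg integrable_continuous_real continuous_intros) simp
      then show ?thesis by (intro mult_mono b nn)
    qed
    finally show "integral {a..b} (\<lambda>y. (poly (p i) y)\<^sup>2 * (poly (p j) y)\<^sup>2) \<le> (c * Q i) * (c * Q j)" .
  qed
  also have "\<dots> = (c * (\<Sum>i\<in>UNIV. Q i))\<^sup>2"
    by (simp only: power2_eq_square sum_distrib_left[of c] sum_product)
  finally have "sqrt (integral {a..b} (\<lambda>y. norm (z y) ^ 4)) \<le> c * (\<Sum>i\<in>UNIV. Q i)"
    using c Q by (simp add: real_le_lsqrt sum_nonneg)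
  then show ?thesis unfolding I2 c_def .
qed

text \<open>A piecewise polynomial that depends on time is thereby described on a cell by finitely many functions of
  time, its values at the nodes, which is how time differentiability at each point becomes uniform in space.\<close>

lemma lagrange_interpolation:
  fixes a b :: real
  assumes "a < b"
  obtains Y :: "real set" and L :: "real \<Rightarrow> real poly"
  where "finite Y" "Y \<subseteq> {a<..<b}" "\<And>z. degree (L z) \<le> k"
    "\<And>p y. degree p \<le> k \<Longrightarrow> poly p y = (\<Sum>z\<in>Y. poly (L z) y * poly p z)"
proof -
  have "infinite {a<..<b}" using assms by (rule infinite_Ioo)
  then obtain Y where Y: "finite Y" "card Y = Suc k" "Y \<subseteq> {a<..<b}"
    using infinite_arbitrarily_large by blast
  define L where "L = (\<lambda>z. if z \<in> Y then \<Prod>w\<in>Y - {z}. smult (1 / (z - w)) [:- w, 1:] else 0)"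
  have deg: "degree (L z) \<le> k" for z
  proof (cases "z \<in> Y")
    case True
    have "degree (\<Prod>w\<in>Y - {z}. smult (1 / (z - w)) [:- w, 1:]) \<le> (\<Sum>w\<in>Y - {z}. degree (smult (1 / (z - w)) [:- w, 1:]))"
      by (rule degree_prod_sum_le[unfolded comp_def]) (use Y in simp)
    also have "\<dots> \<le> (\<Sum>w\<in>Y - {z}. 1)"
      by (intro sum_mono order_trans[OF degree_smult_le]) simp
    also have "\<dots> = k" using Y True by simp
    finally show ?thesis using True by (simp add: L_def)
  qed (simp add: L_def)
  have val: "poly (L z) w = (if w = z then 1 else 0)" if "z \<in> Y" "w \<in> Y" for z w
  proof (cases "w = z")
    case True
    have "poly (L z) z = (\<Prod>v\<in>Y - {z}. poly (smult (1 / (z - v)) [:- v, 1:]) z)"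
      using that by (simp only: L_def poly_prod if_True)
    also have "\<dots> = 1" by (rule prod.neutral) (auto simp: divide_simps)
    finally show ?thesis using True by simp
  next
    case False
    then have "poly (L z) w = 0"
      using that Y by (auto simp: L_def poly_prod prod_zero_iff)
    then show ?thesis using False by simp
  qed
  have "poly p y = (\<Sum>z\<in>Y. poly (L z) y * poly p z)" if p: "degree p \<le> k" for p y
  proof -
    have "p = (\<Sum>z\<in>Y. smult (poly p z) (L z))"
    proof (rule poly_eqI_degree)
      fix w assume w: "w \<in> Y"
      have "(\<Sum>z\<in>Y. poly p z * poly (L z) w) = (\<Sum>z\<in>Y. if w = z then poly p z else 0)"
        by (intro sum.cong refl) (use w val in auto)
      then show "poly p w = poly (\<Sum>z\<in>Y. smult (poly p z) (L z)) w"
        using w Y by (simp add: poly_sum)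
    next
      show "card Y > degree p" using p Y by simp
      have "degree (\<Sum>z\<in>Y. smult (poly p z) (L z)) \<le> k"
        by (intro degree_sum_le Y order_trans[OF degree_smult_le] deg)
      then show "card Y > degree (\<Sum>z\<in>Y. smult (poly p z) (L z))" using Y by simp
    qed
    then have "poly p y = poly (\<Sum>z\<in>Y. smult (poly p z) (L z)) y" by simp
    then show ?thesis by (simp add: poly_sum mult.commute)
  qed
  then show ?thesis using that Y deg by blast
qed

section \<open>Broken polynomials and the projection\<close>

lemma integral_cong_Ioo:
  fixes f g :: "real \<Rightarrow> 'b::banach"
  assumes "\<And>y. y \<in> {a<..<b} \<Longrightarrow> f y = g y"
  shows "integral {a..b} f = integral {a..b} g"
  unfolding integral_open_interval_real by (rule integral_cong) (rule assms)

lemma integrable_cong_Ioo: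
  fixes f g :: "real \<Rightarrow> 'b::banach"
  assumes "g integrable_on {a..b}" "\<And>y. y \<in> {a<..<b} \<Longrightarrow> f y = g y"
  shows "f integrable_on {a..b}"
  using assms unfolding integrable_on_Icc_iff_Ioo by (metis (no_types, lifting) integrable_cong)

lemma one_sided_limits:
  fixes v g :: "real \<Rightarrow> 'b::t2_space"
  assumes ab: "a < b" and g: "continuous_on {a..b} g" and eq: "\<And>y. y \<in> {a<..<b} \<Longrightarrow> v y = g y"
  shows right_lim_eq: "right_lim v a = g a" and left_lim_eq: "left_lim v b = g b"
proof -
  have "\<forall>\<^sub>F y in at_right a. g y = v y"
    using eventually_at_right_real[OF ab] by eventually_elim (simp add: eq)
  then have "(v \<longlongrightarrow> g a) (at_right a)"
    using continuous_on_Icc_at_rightD[OF g ab] Lim_transform_eventually by blast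
  then show "right_lim v a = g a" by (intro tendsto_Lim) auto
  have "\<forall>\<^sub>F y in at_left b. g y = v y"
    using eventually_at_left_real[OF ab] by eventually_elim (simp add: eq)
  then have "(v \<longlongrightarrow> g b) (at_left b)"
    using continuous_on_Icc_at_leftD[OF g ab] Lim_transform_eventually by blast
  then show "left_lim v b = g b" by (intro tendsto_Lim) auto
qed

definition vpoly :: "('m::finite \<Rightarrow> real poly) \<Rightarrow> real \<Rightarrow> real ^ 'm" where
  "vpoly p y = (\<chi> i. poly (p i) y)"

lemma vpoly_nth [simp]: "vpoly p y $ i = poly (p i) y"
  by (simp add: vpoly_def)

lemma continuous_on_vpoly [continuous_intros]: "continuous_on S (vpoly p)"
  unfolding vpoly_def[abs_def] by (intro continuous_on_vec_lambda continuous_intros)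

lemma has_vector_derivative_vpoly:
  "(vpoly p has_vector_derivative vpoly (\<lambda>i. pderiv (p i)) y) (at y within S)"
proof -
  have "((\<lambda>y. \<Sum>i\<in>UNIV. poly (p i) y *\<^sub>R (axis i 1 :: real ^ 'a)) has_vector_derivative
      (\<Sum>i\<in>UNIV. poly (pderiv (p i)) y *\<^sub>R axis i 1)) (at y within S)"
  proof (rule has_vector_derivative_sum)
    fix i
    show "((\<lambda>y. poly (p i) y *\<^sub>R (axis i 1 :: real ^ 'a)) has_vector_derivative
        poly (pderiv (p i)) y *\<^sub>R axis i 1) (at y within S)"
      using has_vector_derivative_scaleR[OF has_field_derivative_at_within[OF poly_DERIV] has_vector_derivative_const]
      by simp
  qed
  moreover have "(\<Sum>i\<in>UNIV. poly (r i) y *\<^sub>R (axis i 1 :: real ^ 'a)) = vpoly r y" for r y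
    using basis_expansion[of "vpoly r y"] by (simp add: scalar_mult_eq_scaleR)
  ultimately show ?thesis by simp
qed

lemma mesh_less:
  assumes "mesh N x" "i < j" "j \<le> N"
  shows "x i < x j"
  using assms by (auto simp: mesh_def strict_mono_on_def)

lemma mesh_mono:
  assumes "mesh N x" "i \<le> j" "j \<le> N"
  shows "x i \<le> x j"
  using mesh_less[OF assms(1), of i j] assms(2,3) by (cases "i = j") auto

lemma mesh_cell:
  assumes "mesh N x" "j \<in> {1..N}"
  shows "x (j - 1) < x j"
  using assms by (intro mesh_less) auto

lemma open_cell_unique:
  assumes m: "mesh N x" and "i \<in> {1..N}" "j \<in> {1..N}" "y \<in> open_cell x i" "y \<in> open_cell x j"
  shows "i = j"
proof -
  have "\<not> i < j" if "i \<in> {1..N}" "j \<in> {1..N}" "y \<in> open_cell x i" "y \<in> open_cell x j" for i j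
  proof
    assume "i < j"
    then have "x i \<le> x (j - 1)" using that by (intro mesh_mono[OF m]) auto
    then show False using that by auto
  qed
  then show ?thesis using assms by (meson linorder_neqE_nat)
qed

lemma open_cell_subset:
  assumes m: "mesh N x" and j: "j \<in> {1..N}"
  shows "open_cell x j \<subseteq> {x 0..x N}"
proof -
  have "x 0 \<le> x (j - 1)" "x j \<le> x N" using j by (auto intro!: mesh_mono[OF m])
  then show ?thesis by auto
qed

lemma Vkm_on_cell:
  assumes "v \<in> Vkm k N x" "j \<in> {1..N}"
  obtains p where "\<And>i. degree (p i) \<le> k" "\<And>y. y \<in> open_cell x j \<Longrightarrow> v y = vpoly p y"
proof -
  have "\<forall>i. \<exists>p. degree p \<le> k \<and> (\<forall>y\<in>open_cell x j. v y $ i = poly p y)"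
    using assms by (auto simp: Vkm_def Vk_def)
  then obtain p where "\<And>i. degree (p i) \<le> k \<and> (\<forall>y\<in>open_cell x j. v y $ i = poly (p i) y)"
    by metis
  then show ?thesis by (intro that[of p]) (auto simp: vec_eq_iff)
qed

lemma cell_poly_in_Vk:
  assumes "mesh N x" "j \<in> {1..N}" "degree r \<le> k"
  shows "(\<lambda>y. if y \<in> open_cell x j then poly r y else 0) \<in> Vk k N x"
  unfolding Vk_def
proof (intro CollectI ballI)
  fix i assume i: "i \<in> {1..N}"
  show "\<exists>p. degree p \<le> k \<and> (\<forall>y\<in>open_cell x i. (if y \<in> open_cell x j then poly r y else 0) = poly p y)"
  proof (cases "i = j")
    case True
    then show ?thesis using assms by auto
  next
    case False
    then have "y \<notin> open_cell x j" if "y \<in> open_cell x i" for y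
      using open_cell_unique[OF assms(1) i assms(2) that] by blast
    then show ?thesis by (intro exI[of _ 0]) (simp del: greaterThanLessThan_iff)
  qed
qed

definition piecewise_continuous :: "nat \<Rightarrow> (nat \<Rightarrow> real) \<Rightarrow> (real \<Rightarrow> 'b::topological_space) \<Rightarrow> bool" where
  "piecewise_continuous N x g \<longleftrightarrow>
    (\<forall>j\<in>{1..N}. \<exists>G. continuous_on (cell x j) G \<and> (\<forall>y\<in>open_cell x j. g y = G y))"

lemma has_integral_cells:
  fixes g :: "real \<Rightarrow> 'b::banach"
  assumes m: "mesh N x" and int: "\<And>j. j \<in> {1..N} \<Longrightarrow> g integrable_on cell x j"
  shows "n \<le> N \<Longrightarrow> (g has_integral (\<Sum>j=1..n. integral (cell x j) g)) {x 0..x n}"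
proof (induction n)
  case 0
  then show ?case by (simp add: has_integral_refl)
next
  case (Suc n)
  have "(g has_integral (\<Sum>j=1..n. integral (cell x j) g) + integral (cell x (Suc n)) g) {x 0..x (Suc n)}"
  proof (rule has_integral_combine[where c = "x n"])
    show "x 0 \<le> x n" "x n \<le> x (Suc n)" using Suc.prems by (auto intro!: mesh_mono[OF m])
    show "(g has_integral (\<Sum>j=1..n. integral (cell x j) g)) {x 0..x n}" using Suc by simp
    show "(g has_integral integral (cell x (Suc n)) g) {x n..x (Suc n)}"
      using int[of "Suc n"] Suc.prems by (auto simp: integrable_integral)
  qed
  then show ?case by simp
qed

text \<open>Existence of the global projection is cellwise; conversely, testing with polynomials supported in one
  cell recovers the cellwise characterisation of whichever representative has been selected.\<close>

lemma L2_proj_cellwise: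
  fixes g :: "real \<Rightarrow> real"
  assumes m: "mesh N x" and g: "piecewise_continuous N x g"
  shows L2_proj_in_Vk: "L2_proj k N x g \<in> Vk k N x"
    and L2_proj_orthogonal: "\<And>j r. j \<in> {1..N} \<Longrightarrow> degree r \<le> k \<Longrightarrow>
      integral (cell x j) (\<lambda>y. L2_proj k N x g y * poly r y) = integral (cell x j) (\<lambda>y. g y * poly r y)"
proof -
  let ?P = "\<lambda>p. p \<in> Vk k N x \<and>
     (\<forall>v\<in>Vk k N x. integral {x 0..x N} (\<lambda>y. p y * v y) = integral {x 0..x N} (\<lambda>y. g y * v y))"
  have "\<exists>p. ?P p"
  proof -
    have "\<forall>j\<in>{1..N}. \<exists>G. continuous_on (cell x j) G \<and> (\<forall>y\<in>open_cell x j. g y = G y)"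
      using g by (simp add: piecewise_continuous_def)
    then obtain G where G: "\<And>j. j \<in> {1..N} \<Longrightarrow> continuous_on (cell x j) (G j)"
      "\<And>j y. j \<in> {1..N} \<Longrightarrow> y \<in> open_cell x j \<Longrightarrow> g y = G j y"
      by metis
    have "\<forall>j\<in>{1..N}. \<exists>q. degree q \<le> k \<and>
        (\<forall>r. degree r \<le> k \<longrightarrow> integral (cell x j) (\<lambda>y. poly q y * poly r y) = integral (cell x j) (\<lambda>y. G j y * poly r y))"
      using ex_projection mesh_cell[OF m] G(1) by blast
    then obtain q where q: "\<And>j. j \<in> {1..N} \<Longrightarrow> degree (q j) \<le> k"
      "\<And>j r. j \<in> {1..N} \<Longrightarrow> degree r \<le> k \<Longrightarrow>
        integral (cell x j) (\<lambda>y. poly (q j) y * poly r y) = integral (cell x j) (\<lambda>y. G j y * poly r y)"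
      by metis
    define p where "p = (\<lambda>y. \<Sum>j=1..N. if y \<in> open_cell x j then poly (q j) y else 0)"
    have p: "p y = poly (q j) y" if "j \<in> {1..N}" "y \<in> open_cell x j" for j y
    proof -
      have "p y = (\<Sum>i=1..N. if i = j then poly (q j) y else 0)"
        unfolding p_def by (intro sum.cong refl) (use open_cell_unique[OF m] that in auto)
      then show ?thesis using that by simp
    qed
    have "p \<in> Vk k N x" unfolding Vk_def using p q by blast
    moreover have "integral {x 0..x N} (\<lambda>y. p y * v y) = integral {x 0..x N} (\<lambda>y. g y * v y)" if v: "v \<in> Vk k N x" for v
    proof -
      have cellr: "(\<lambda>y. p y * v y) integrable_on cell x j \<and> (\<lambda>y. g y * v y) integrable_on cell x j \<and>
          integral (cell x j) (\<lambda>y. p y * v y) = integral (cell x j) (\<lambda>y. g y * v y)" if j: "j \<in> {1..N}" for j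
      proof -
        obtain r where r: "degree r \<le> k" "\<And>y. y \<in> open_cell x j \<Longrightarrow> v y = poly r y"
          using v j unfolding Vk_def by blast
        have I1: "(\<lambda>y. poly (q j) y * poly r y) integrable_on cell x j" and I2: "(\<lambda>y. G j y * poly r y) integrable_on cell x j"
          by (intro integrable_continuous_real continuous_intros G j)+
        have "(\<lambda>y. p y * v y) integrable_on cell x j"
          by (rule integrable_cong_Ioo[OF I1]) (simp add: p[OF j] r)
        moreover have "(\<lambda>y. g y * v y) integrable_on cell x j"
          by (rule integrable_cong_Ioo[OF I2]) (simp add: G(2)[OF j] r)
        moreover have "integral (cell x j) (\<lambda>y. p y * v y) = integral (cell x j) (\<lambda>y. poly (q j) y * poly r y)"
          by (rule integral_cong_Ioo) (simp add: p[OF j] r)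
        moreover have "integral (cell x j) (\<lambda>y. g y * v y) = integral (cell x j) (\<lambda>y. G j y * poly r y)"
          by (rule integral_cong_Ioo) (simp add: G(2)[OF j] r)
        ultimately show ?thesis using q(2)[OF j r(1)] by simp
      qed
      have "integral {x 0..x N} (\<lambda>y. p y * v y) = (\<Sum>j=1..N. integral (cell x j) (\<lambda>y. p y * v y))"
        using has_integral_cells[OF m, of "\<lambda>y. p y * v y" N] cellr by (auto intro: integral_unique)
      also have "\<dots> = (\<Sum>j=1..N. integral (cell x j) (\<lambda>y. g y * v y))"
        using cellr by (intro sum.cong) auto
      also have "\<dots> = integral {x 0..x N} (\<lambda>y. g y * v y)"
        using has_integral_cells[OF m, of "\<lambda>y. g y * v y" N] cellr by (auto dest: integral_unique)
      finally show ?thesis .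
    qed
    ultimately show ?thesis by blast
  qed
  then have P: "?P (L2_proj k N x g)" unfolding L2_proj_def by (rule someI_ex)
  then show "L2_proj k N x g \<in> Vk k N x" by blast
  show "integral (cell x j) (\<lambda>y. L2_proj k N x g y * poly r y) = integral (cell x j) (\<lambda>y. g y * poly r y)"
    if j: "j \<in> {1..N}" and r: "degree r \<le> k" for j r
  proof -
    have loc: "integral {x 0..x N} (\<lambda>y. F y * (if y \<in> open_cell x j then poly r y else 0)) = integral (cell x j) (\<lambda>y. F y * poly r y)"
      for F :: "real \<Rightarrow> real"
    proof -
      have "(\<lambda>y. F y * (if y \<in> open_cell x j then poly r y else 0)) = (\<lambda>y. if y \<in> open_cell x j then F y * poly r y else 0)"
        by auto
      then have "integral {x 0..x N} (\<lambda>y. F y * (if y \<in> open_cell x j then poly r y else 0))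
          = integral (open_cell x j \<inter> {x 0..x N}) (\<lambda>y. F y * poly r y)"
        by (simp only: integral_restrict_Int)
      also have "open_cell x j \<inter> {x 0..x N} = open_cell x j" using open_cell_subset[OF m j] by blast
      finally show ?thesis by (simp only: integral_open_interval_real)
    qed
    show ?thesis
      using bspec[OF conjunct2[OF P] cell_poly_in_Vk[OF m j r]] unfolding loc .
  qed
qed

lemma piecewise_continuous_nth:
  fixes g :: "real \<Rightarrow> real ^ 'm::finite"
  assumes "piecewise_continuous N x g"
  shows "piecewise_continuous N x (\<lambda>y. g y $ i)"
  unfolding piecewise_continuous_def
proof
  fix j assume "j \<in> {1..N}"
  then obtain G where G: "continuous_on (cell x j) G" "\<forall>y\<in>open_cell x j. g y = G y"
    using assms unfolding piecewise_continuous_def by blast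
  have "continuous_on (cell x j) (\<lambda>y. G y $ i)" by (intro continuous_intros G)
  then show "\<exists>G. continuous_on (cell x j) G \<and> (\<forall>y\<in>open_cell x j. g y $ i = G y)"
    using G(2) by (intro exI[of _ "\<lambda>y. G y $ i"]) auto
qed

lemma L2_proj_vec_in_Vkm:
  assumes "mesh N x" "piecewise_continuous N x g"
  shows "L2_proj_vec k N x g \<in> Vkm k N x"
  unfolding Vkm_def L2_proj_vec_def[abs_def]
  using L2_proj_in_Vk[OF assms(1) piecewise_continuous_nth[OF assms(2)]] by simp

definition is_projection :: "nat \<Rightarrow> real \<Rightarrow> real \<Rightarrow> (real \<Rightarrow> real ^ 'm::finite) \<Rightarrow> ('m \<Rightarrow> real poly) \<Rightarrow> bool" where
  "is_projection k a b g q \<longleftrightarrow> (\<forall>i. degree (q i) \<le> k \<and>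
    (\<forall>r. degree r \<le> k \<longrightarrow> integral {a..b} (\<lambda>y. poly (q i) y * poly r y) = integral {a..b} (\<lambda>y. g y $ i * poly r y)))"

lemma is_projection_unique:
  assumes "a < b" "is_projection k a b g p" "is_projection k a b g q"
  shows "p = q"
proof
  fix i
  show "p i = q i"
    using assms(2,3) unfolding is_projection_def by (intro projection_unique[OF assms(1), of _ k]) auto
qed

lemma is_projection_cong:
  assumes "\<And>y. y \<in> {a<..<b} \<Longrightarrow> g y = g' y" "is_projection k a b g q"
  shows "is_projection k a b g' q"
proof -
  have "integral {a..b} (\<lambda>y. g y $ i * poly r y) = integral {a..b} (\<lambda>y. g' y $ i * poly r y)" for i r
    by (rule integral_cong_Ioo) (simp add: assms(1))
  then show ?thesis using assms(2) by (simp add: is_projection_def)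
qed

lemma is_projection_diff_const:
  assumes g: "continuous_on {a..b} g" and q: "is_projection k a b g q"
  shows "is_projection k a b (\<lambda>y. g y - c) (\<lambda>i. q i - [:c $ i:])"
  unfolding is_projection_def
proof (intro allI conjI impI)
  fix i
  show "degree (q i - [:c $ i:]) \<le> k"
    using q by (intro degree_diff_le) (auto simp: is_projection_def)
  fix r :: "real poly" assume r: "degree r \<le> k"
  have "integral {a..b} (\<lambda>y. poly (q i - [:c $ i:]) y * poly r y)
      = integral {a..b} (\<lambda>y. poly (q i) y * poly r y) - integral {a..b} (\<lambda>y. c $ i * poly r y)"
    unfolding poly_diff poly_pCons left_diff_distrib
    by (subst integral_diff[symmetric]) (auto intro!: integrable_continuous_real continuous_intros)
  also have "integral {a..b} (\<lambda>y. poly (q i) y * poly r y) = integral {a..b} (\<lambda>y. g y $ i * poly r y)"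
    using q r by (simp add: is_projection_def)
  also have "\<dots> - integral {a..b} (\<lambda>y. c $ i * poly r y) = integral {a..b} (\<lambda>y. (g y - c) $ i * poly r y)"
    unfolding vector_minus_component left_diff_distrib
    by (subst integral_diff[symmetric]) (auto intro!: integrable_continuous_real continuous_intros g)
  finally show "integral {a..b} (\<lambda>y. poly (q i - [:c $ i:]) y * poly r y)
      = integral {a..b} (\<lambda>y. (g y - c) $ i * poly r y)" .
qed

lemma is_projection_inner:
  assumes g: "continuous_on {a..b} g" and q: "is_projection k a b g q" and r: "\<And>i. degree (r i) \<le> k"
  shows "integral {a..b} (\<lambda>y. vpoly q y \<bullet> vpoly r y) = integral {a..b} (\<lambda>y. g y \<bullet> vpoly r y)"
proof -
  have "integral {a..b} (\<lambda>y. vpoly q y \<bullet> vpoly r y) = (\<Sum>i\<in>UNIV. integral {a..b} (\<lambda>y. poly (q i) y * poly (r i) y))"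
    unfolding inner_vec_def inner_real_def vpoly_nth
    by (intro integral_sum integrable_continuous_real continuous_intros) simp
  also have "\<dots> = (\<Sum>i\<in>UNIV. integral {a..b} (\<lambda>y. g y $ i * poly (r i) y))"
    using q r by (intro sum.cong refl) (auto simp: is_projection_def)
  also have "\<dots> = integral {a..b} (\<lambda>y. g y \<bullet> vpoly r y)"
    unfolding inner_vec_def inner_real_def vpoly_nth
    by (intro integral_sum[symmetric] integrable_continuous_real continuous_intros g) simp
  finally show ?thesis .
qed

lemma L2_proj_vec_on_cell:
  assumes m: "mesh N x" and g: "piecewise_continuous N x g" and j: "j \<in> {1..N}"
  obtains q where "is_projection k (x (j - 1)) (x j) g q"
    "\<And>y. y \<in> open_cell x j \<Longrightarrow> L2_proj_vec k N x g y = vpoly q y"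
proof -
  obtain q where q: "\<And>i. degree (q i) \<le> k" "\<And>y. y \<in> open_cell x j \<Longrightarrow> L2_proj_vec k N x g y = vpoly q y"
    using Vkm_on_cell[OF L2_proj_vec_in_Vkm[OF m g] j] by blast
  have "integral (cell x j) (\<lambda>y. poly (q i) y * poly r y) = integral (cell x j) (\<lambda>y. g y $ i * poly r y)"
    if r: "degree r \<le> k" for i r
  proof -
    have "L2_proj k N x (\<lambda>z. g z $ i) y = poly (q i) y" if "y \<in> open_cell x j" for y
      using arg_cong[OF q(2)[OF that], of "\<lambda>v. v $ i"] by (simp add: L2_proj_vec_def)
    then have "integral (cell x j) (\<lambda>y. poly (q i) y * poly r y)
        = integral (cell x j) (\<lambda>y. L2_proj k N x (\<lambda>z. g z $ i) y * poly r y)"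
      by (intro integral_cong_Ioo) simp
    also have "\<dots> = integral (cell x j) (\<lambda>y. g y $ i * poly r y)"
      by (rule L2_proj_orthogonal[OF m piecewise_continuous_nth[OF g] j r])
    finally show ?thesis .
  qed
  then show ?thesis using q by (intro that[of q]) (auto simp: is_projection_def)
qed

section \<open>Differentiating the entropy of a cell in time\<close>

text \<open>The remainder of the first-order expansion is controlled by the oscillation of the gradient, which is
  uniform on a compact neighbourhood of \<open>K\<close>.\<close>

lemma uniform_first_order:
  fixes U :: "real ^ 'm::finite \<Rightarrow> real"
  assumes \<Omega>: "open \<Omega>" and K: "compact K" "K \<subseteq> \<Omega>"
    and d: "\<And>w. w \<in> \<Omega> \<Longrightarrow> U differentiable (at w)" and g: "continuous_on \<Omega> (grad U)" and e: "e > 0"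
  obtains \<delta> where "\<delta> > 0"
    "\<And>c w. c \<in> K \<Longrightarrow> norm (w - c) < \<delta> \<Longrightarrow> w \<in> \<Omega> \<and> \<bar>U w - U c - grad U c \<bullet> (w - c)\<bar> \<le> e * norm (w - c)"
proof -
  obtain \<rho> where \<rho>: "\<rho> > 0" "(\<Union>c\<in>K. cball c \<rho>) \<subseteq> \<Omega>"
    using compact_subset_open_imp_cball_epsilon_subset[OF K(1) \<Omega> K(2)] by blast
  define K' where "K' = {c + v |c v. c \<in> K \<and> v \<in> cball 0 \<rho>}"
  have "compact K'" unfolding K'_def by (intro compact_sums K compact_cball)
  have in_K': "c + v \<in> K'" if "c \<in> K" "norm v \<le> \<rho>" for c v
    using that by (auto simp: K'_def)
  have "c + v \<in> \<Omega>" if "c \<in> K" "v \<in> cball 0 \<rho>" for c v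
  proof -
    have "c + v \<in> cball c \<rho>" using that by (simp add: dist_norm)
    then show ?thesis using \<rho>(2) that by blast
  qed
  then have sub: "K' \<subseteq> \<Omega>" by (auto simp: K'_def)
  have "uniformly_continuous_on K' (grad U)"
    by (intro compact_uniformly_continuous continuous_on_subset[OF g sub] \<open>compact K'\<close>)
  then obtain \<eta> where \<eta>: "\<eta> > 0" "\<And>a b. a \<in> K' \<Longrightarrow> b \<in> K' \<Longrightarrow> dist b a < \<eta> \<Longrightarrow> dist (grad U b) (grad U a) < e"
    unfolding uniformly_continuous_on_def using e by metis
  show ?thesis
  proof (rule that[of "min \<rho> \<eta>"])
    show "min \<rho> \<eta> > 0" using \<rho> \<eta> by simp
    fix c w assume c: "c \<in> K" and w: "norm (w - c) < min \<rho> \<eta>"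
    define z where "z = w - c"
    have nz: "norm z < \<rho>" "norm z < \<eta>" using w by (auto simp: z_def)
    have seg: "c + s *\<^sub>R z \<in> K'" "norm (s *\<^sub>R z) \<le> norm z" if "0 \<le> s" "s \<le> 1" for s
    proof -
      show "norm (s *\<^sub>R z) \<le> norm z" using that by (simp add: mult_left_le_one_le)
      then show "c + s *\<^sub>R z \<in> K'" using nz by (intro in_K' c) simp
    qed
    have "((\<lambda>s. U (c + s *\<^sub>R z)) has_real_derivative grad U (c + s *\<^sub>R z) \<bullet> z) (at s)" if "0 \<le> s" "s \<le> 1" for s
    proof -
      have "c + s *\<^sub>R z \<in> \<Omega>" using seg[OF that] sub by blast
      from has_real_derivative_line[OF d[OF this]] show ?thesis
        by (simp add: grad_def inner_vec_def mult.commute)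
    qed
    then obtain s where s: "0 < s" "s < 1" "U (c + 1 *\<^sub>R z) - U (c + 0 *\<^sub>R z) = (1 - 0) * (grad U (c + s *\<^sub>R z) \<bullet> z)"
      using MVT2[of 0 1 "\<lambda>s. U (c + s *\<^sub>R z)" "\<lambda>s. grad U (c + s *\<^sub>R z) \<bullet> z"] by auto
    have "dist (grad U (c + s *\<^sub>R z)) (grad U c) < e"
      using seg[of s] seg[of 0] s nz by (intro \<eta>) (auto simp: dist_norm)
    then have "norm (grad U (c + s *\<^sub>R z) - grad U c) * norm z \<le> e * norm z"
      by (intro mult_right_mono) (auto simp: dist_norm)
    moreover have "U w - U c - grad U c \<bullet> (w - c) = (grad U (c + s *\<^sub>R z) - grad U c) \<bullet> z"
      using s(3) by (simp add: z_def inner_diff_left)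
    moreover have "w \<in> \<Omega>" using seg(1)[of 1] sub by (auto simp: z_def)
    ultimately show "w \<in> \<Omega> \<and> \<bar>U w - U c - grad U c \<bullet> (w - c)\<bar> \<le> e * norm (w - c)"
      using Cauchy_Schwarz_ineq2[of "grad U (c + s *\<^sub>R z) - grad U c" z] by (simp add: z_def)
  qed
qed

lemma has_derivative_within_bound:
  assumes "(f has_vector_derivative f') (at t within T)" "e > 0"
  shows "\<forall>\<^sub>F s in at t within T. norm (f s - f t - (s - t) *\<^sub>R f') \<le> e * \<bar>s - t\<bar>"
proof -
  obtain d where "d > 0" "\<forall>s\<in>T. norm (s - t) < d \<longrightarrow> norm (f s - f t - (s - t) *\<^sub>R f') \<le> e * norm (s - t)"
    using assms unfolding has_vector_derivative_def has_derivative_within_alt by blast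
  then show ?thesis unfolding eventually_at by (auto simp: dist_norm intro!: exI[of _ d])
qed

text \<open>The state on the cell depends on time through finitely many nodal values only, so its difference quotients
  converge uniformly in space, and the limit may be taken under the integral.\<close>

lemma has_derivative_integral_entropy:
  fixes U :: "real ^ 'm::finite \<Rightarrow> real" and u :: "real \<Rightarrow> real \<Rightarrow> real ^ 'm"
  assumes ab: "a < b" and \<Omega>: "open \<Omega>"
    and d: "\<And>w. w \<in> \<Omega> \<Longrightarrow> U differentiable (at w)" and g: "continuous_on \<Omega> (grad U)"
    and Y: "finite Y"
    and rep: "\<And>s y. s \<in> T \<Longrightarrow> y \<in> {a<..<b} \<Longrightarrow> u s y = (\<Sum>z\<in>Y. poly (L z) y *\<^sub>R u s z)"
    and t: "t \<in> T" and du: "\<And>z. z \<in> Y \<Longrightarrow> ((\<lambda>s. u s z) has_vector_derivative u' z) (at t within T)"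
    and in\<Omega>: "\<And>y. y \<in> {a..b} \<Longrightarrow> (\<Sum>z\<in>Y. poly (L z) y *\<^sub>R u t z) \<in> \<Omega>"
  shows "((\<lambda>s. integral {a..b} (\<lambda>y. U (u s y))) has_real_derivative
      integral {a..b} (\<lambda>y. grad U (u t y) \<bullet> (\<Sum>z\<in>Y. poly (L z) y *\<^sub>R u' z))) (at t within T)"
proof -
  define V where "V = (\<lambda>s y. \<Sum>z\<in>Y. poly (L z) y *\<^sub>R u s z)"
  define V' where "V' = (\<lambda>y. \<Sum>z\<in>Y. poly (L z) y *\<^sub>R u' z)"
  define E where "E = (\<lambda>s. integral {a..b} (\<lambda>y. U (V s y)))"
  define D where "D = integral {a..b} (\<lambda>y. grad U (V t y) \<bullet> V' y)"
  define K where "K = V t ` {a..b}"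
  have cV: "continuous_on S (V s)" and cV': "continuous_on S V'" for S s
    unfolding V_def V'_def by (intro continuous_intros)+
  have "compact K" unfolding K_def by (intro compact_continuous_image cV compact_Icc)
  moreover have "K \<subseteq> \<Omega>" unfolding K_def V_def using in\<Omega> by blast
  ultimately have K: "compact K" "K \<subseteq> \<Omega>" .
  have U: "continuous_on \<Omega> U"
    using d by (auto intro!: differentiable_imp_continuous_within continuous_at_imp_continuous_on)
  have bd: "\<exists>B>0. \<forall>y\<in>{a..b}. norm (G y) \<le> B" if "continuous_on {a..b} G" for G :: "real \<Rightarrow> 'b::real_normed_vector"
  proof -
    have "bounded (G ` {a..b})" using that by (intro compact_imp_bounded compact_continuous_image) auto
    then show ?thesis unfolding bounded_pos by auto
  qed
  have cgV: "continuous_on {a..b} (\<lambda>y. grad U (V t y))"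
    by (rule continuous_on_compose2[OF g cV]) (use in\<Omega> in \<open>auto simp: V_def\<close>)
  obtain Bv where Bv: "Bv > 0" "\<And>y. y \<in> {a..b} \<Longrightarrow> norm (V' y) \<le> Bv" using bd[OF cV'] by blast
  obtain Bg where Bg: "Bg > 0" "\<And>y. y \<in> {a..b} \<Longrightarrow> norm (grad U (V t y)) \<le> Bg" using bd[OF cgV] by blast
  have "continuous_on {a..b} (\<lambda>y. \<Sum>z\<in>Y. \<bar>poly (L z) y\<bar>)" by (intro continuous_intros)
  then obtain Bl where Bl: "Bl > 0" "\<And>y. y \<in> {a..b} \<Longrightarrow> (\<Sum>z\<in>Y. \<bar>poly (L z) y\<bar>) \<le> Bl"
    using bd[of "\<lambda>y. \<Sum>z\<in>Y. \<bar>poly (L z) y\<bar>"] by (auto simp: abs_of_nonneg sum_nonneg)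
  have unif: "\<forall>\<^sub>F s in at t within T. \<forall>y\<in>{a..b}. norm (V s y - V t y - (s - t) *\<^sub>R V' y) \<le> e * \<bar>s - t\<bar>" if e: "e > 0" for e
  proof -
    have "\<forall>\<^sub>F s in at t within T. \<forall>z\<in>Y. norm (u s z - u t z - (s - t) *\<^sub>R u' z) \<le> (e / Bl) * \<bar>s - t\<bar>"
      by (intro eventually_ball_finite Y ballI has_derivative_within_bound du) (use e Bl in auto)
    then show ?thesis
    proof eventually_elim
      case (elim s)
      show ?case
      proof
        fix y assume y: "y \<in> {a..b}"
        have "V s y - V t y - (s - t) *\<^sub>R V' y = (\<Sum>z\<in>Y. poly (L z) y *\<^sub>R (u s z - u t z - (s - t) *\<^sub>R u' z))"
          by (simp add: V_def V'_def scaleR_diff_right sum_subtractf scaleR_sum_right mult.commute)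
        also have "norm \<dots> \<le> (\<Sum>z\<in>Y. \<bar>poly (L z) y\<bar> * ((e / Bl) * \<bar>s - t\<bar>))"
          using elim by (intro sum_norm_le, unfold norm_scaleR) (intro mult_left_mono abs_ge_zero, blast)
        also have "\<dots> = (\<Sum>z\<in>Y. \<bar>poly (L z) y\<bar>) * ((e / Bl) * \<bar>s - t\<bar>)" by (simp only: sum_distrib_right)
        also have "\<dots> \<le> Bl * ((e / Bl) * \<bar>s - t\<bar>)" using Bl e y by (intro mult_right_mono) auto
        also have "\<dots> = e * \<bar>s - t\<bar>" using Bl by simp
        finally show "norm (V s y - V t y - (s - t) *\<^sub>R V' y) \<le> e * \<bar>s - t\<bar>" .
      qed
    qed
  qed
  have E_bound: "\<forall>\<^sub>F s in at t within T. \<bar>E s - E t - (s - t) * D\<bar> \<le> e * \<bar>s - t\<bar>" if e: "e > 0" for e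
  proof -
    define c where "c = e / (b - a)"
    have c: "c > 0" using e ab by (simp add: c_def)
    \<comment> \<open>\<open>e1\<close> controls the error of the state and \<open>e2\<close> that of the expansion of \<open>U\<close>; each contributes half of \<open>c\<close>.\<close>
    define e1 where "e1 = min 1 (c / (2 * Bg))"
    define e2 where "e2 = c / (2 * (Bv + 1))"
    have e1: "e1 > 0" "e1 \<le> 1" "Bg * e1 \<le> c / 2" and e2: "e2 > 0" "e2 * (Bv + 1) = c / 2"
      using c Bg Bv by (auto simp: e1_def e2_def min_def field_simps)
    obtain \<delta> where \<delta>: "\<delta> > 0" "\<And>v w. v \<in> K \<Longrightarrow> norm (w - v) < \<delta> \<Longrightarrow>
        w \<in> \<Omega> \<and> \<bar>U w - U v - grad U v \<bullet> (w - v)\<bar> \<le> e2 * norm (w - v)"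
      using uniform_first_order[OF \<Omega> K d g e2(1)] by metis
    have "\<forall>\<^sub>F s in at t within T. dist s t < \<delta> / (Bv + 1)"
      unfolding eventually_at using \<delta>(1) Bv(1) by (intro exI[of _ "\<delta> / (Bv + 1)"]) auto
    with unif[OF e1(1)] show ?thesis
    proof eventually_elim
      case (elim s)
      define r where "r = (\<lambda>y. U (V s y) - U (V t y) - (s - t) * (grad U (V t y) \<bullet> V' y))"
      have pt: "V s y \<in> \<Omega> \<and> \<bar>r y\<bar> \<le> c * \<bar>s - t\<bar>" if y: "y \<in> {a..b}" for y
      proof -
        define q where "q = V s y - V t y - (s - t) *\<^sub>R V' y"
        have q: "norm q \<le> e1 * \<bar>s - t\<bar>" using elim(1) y by (simp add: q_def)
        have dV: "V s y - V t y = q + (s - t) *\<^sub>R V' y" by (simp add: q_def)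
        have "norm (V s y - V t y) \<le> norm q + \<bar>s - t\<bar> * norm (V' y)"
          unfolding dV using norm_triangle_ineq[of q "(s - t) *\<^sub>R V' y"] by simp
        also have "\<dots> \<le> 1 * \<bar>s - t\<bar> + \<bar>s - t\<bar> * Bv"
          using e1 Bv(2)[OF y] by (intro add_mono order_trans[OF q] mult_right_mono mult_left_mono) auto
        finally have n: "norm (V s y - V t y) \<le> (Bv + 1) * \<bar>s - t\<bar>" by (simp add: algebra_simps)
        also have "\<dots> < \<delta>" using elim(2) Bv by (simp add: dist_norm pos_less_divide_eq mult.commute)
        finally have "V s y \<in> \<Omega> \<and> \<bar>U (V s y) - U (V t y) - grad U (V t y) \<bullet> (V s y - V t y)\<bar> \<le> e2 * norm (V s y - V t y)"
          using y by (intro \<delta>(2)) (auto simp: K_def)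
        moreover have "e2 * norm (V s y - V t y) \<le> c / 2 * \<bar>s - t\<bar>"
          using mult_left_mono[OF n, of e2] e2 by (simp add: mult.assoc[symmetric])
        moreover have "\<bar>grad U (V t y) \<bullet> q\<bar> \<le> c / 2 * \<bar>s - t\<bar>"
        proof -
          have "\<bar>grad U (V t y) \<bullet> q\<bar> \<le> norm (grad U (V t y)) * norm q" by (rule Cauchy_Schwarz_ineq2)
          also have "\<dots> \<le> Bg * (e1 * \<bar>s - t\<bar>)" using Bg q y by (intro mult_mono) auto
          also have "\<dots> \<le> c / 2 * \<bar>s - t\<bar>"
            using mult_right_mono[OF e1(3), of "\<bar>s - t\<bar>"] by (simp add: mult.assoc)
          finally show ?thesis .
        qed
        moreover have "r y = (U (V s y) - U (V t y) - grad U (V t y) \<bullet> (V s y - V t y)) + grad U (V t y) \<bullet> q"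
          by (simp add: r_def dV inner_add_right)
        ultimately show ?thesis by (auto simp: abs_le_iff)
      qed
      have i1: "(\<lambda>y. U (V s y)) integrable_on {a..b}"
        by (intro integrable_continuous_real continuous_on_compose2[OF U cV]) (use pt in auto)
      have i2: "(\<lambda>y. U (V t y)) integrable_on {a..b}"
        by (intro integrable_continuous_real continuous_on_compose2[OF U cV]) (use in\<Omega> in \<open>auto simp: V_def\<close>)
      have i3: "(\<lambda>y. grad U (V t y) \<bullet> V' y) integrable_on {a..b}"
        by (intro integrable_continuous_real continuous_intros cgV cV')
      have "(r has_integral (E s - E t - (s - t) * D)) {a..b}"
        unfolding r_def E_def D_def
        by (intro has_integral_diff has_integral_mult_right integrable_integral i1 i2 i3)
      moreover have "norm (r y) \<le> c * \<bar>s - t\<bar>" if "y \<in> cbox a b" for y using pt that by simp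
      ultimately have "norm (E s - E t - (s - t) * D) \<le> c * \<bar>s - t\<bar> * measure lborel (cbox a b)"
        using c by (intro has_integral_bound[of _ r]) auto
      also have "\<dots> = e * \<bar>s - t\<bar>" using ab by (simp add: c_def)
      finally show ?case by simp
    qed
  qed
  have "(E has_real_derivative D) (at t within T)"
    unfolding has_field_derivative_iff
  proof (rule tendstoI)
    fix e :: real assume e: "e > 0"
    have "\<forall>\<^sub>F s in at t within T. s \<noteq> t" by (simp add: eventually_at_filter)
    with E_bound[OF half_gt_zero[OF e]] show "\<forall>\<^sub>F s in at t within T. dist ((E s - E t) / (s - t)) D < e"
    proof eventually_elim
      case (elim s)
      have "(E s - E t) / (s - t) - D = (E s - E t - (s - t) * D) / (s - t)"
        using elim(2) by (simp add: diff_divide_distrib)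
      then have "dist ((E s - E t) / (s - t)) D = \<bar>E s - E t - (s - t) * D\<bar> / \<bar>s - t\<bar>"
        by (simp add: dist_real_def)
      also have "\<dots> \<le> e / 2" using elim by (simp add: pos_divide_le_eq)
      also have "\<dots> < e" using e by simp
      finally show ?case .
    qed
  qed
  moreover have "E s = integral {a..b} (\<lambda>y. U (u s y))" if "s \<in> T" for s
    unfolding E_def by (rule integral_cong_Ioo) (simp add: V_def rep[OF that, symmetric])
  ultimately have "((\<lambda>s. integral {a..b} (\<lambda>y. U (u s y))) has_real_derivative D) (at t within T)"
    by (rule has_field_derivative_transform_within[OF _ zero_less_one t])
  moreover have "D = integral {a..b} (\<lambda>y. grad U (u t y) \<bullet> (\<Sum>z\<in>Y. poly (L z) y *\<^sub>R u' z))"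
    unfolding D_def by (rule integral_cong_Ioo) (simp add: V_def V'_def rep[OF t, symmetric])
  ultimately show ?thesis by simp
qed

section \<open>The entropy balance of one cell\<close>

text \<open>Otherwise a hyperplane would separate the average strictly from all the values that are averaged.\<close>

lemma average_in_convex:
  fixes g :: "real \<Rightarrow> real ^ 'm::finite"
  assumes ab: "a < b" and g: "continuous_on {a..b} g" and K: "closed K" "convex K" "g ` {a..b} \<subseteq> K"
  shows "(1 / (b - a)) *\<^sub>R integral {a..b} g \<in> K"
proof (rule ccontr)
  let ?z = "(1 / (b - a)) *\<^sub>R integral {a..b} g"
  assume "?z \<notin> K"
  then obtain n c where n: "n \<bullet> ?z < c" "\<forall>y\<in>K. c < n \<bullet> y"
    using separating_hyperplane_closed_point[OF K(2,1)] by blast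
  have "(g has_integral integral {a..b} g) {a..b}"
    by (intro integrable_integral integrable_continuous_real g)
  then have int: "((\<lambda>y. n \<bullet> g y) has_integral n \<bullet> integral {a..b} g) {a..b}"
    using has_integral_linear[OF _ bounded_linear_inner_right] by (force simp: o_def)
  have "((\<lambda>y. c) has_integral (b - a) * c) {a..b}"
    using has_integral_const_real[of c a b] ab by simp
  from has_integral_le[OF this int] have "(b - a) * c \<le> n \<bullet> integral {a..b} g"
    using n(2) K(3) by (meson image_subset_iff less_imp_le)
  moreover have "n \<bullet> integral {a..b} g < (b - a) * c"
    using n(1) ab by (simp add: pos_divide_less_eq mult.commute)
  ultimately show False by simp
qed

lemma has_vector_derivative_flux_along:
  assumes f: "f differentiable (at (vpoly P y))"
  shows "((\<lambda>y. f (vpoly P y)) has_vector_derivative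
    (\<Sum>i\<in>UNIV. poly (pderiv (P i)) y *\<^sub>R partial i f (vpoly P y))) (at y within S)"
proof -
  have dP: "(vpoly P has_derivative (\<lambda>r. r *\<^sub>R vpoly (\<lambda>i. pderiv (P i)) y)) (at y within S)"
    using has_vector_derivative_vpoly[of P y S] by (simp add: has_vector_derivative_def)
  have "((\<lambda>y. f (vpoly P y)) has_derivative
      (\<lambda>r. \<Sum>i\<in>UNIV. (r *\<^sub>R vpoly (\<lambda>i. pderiv (P i)) y) $ i *\<^sub>R partial i f (vpoly P y))) (at y within S)"
    by (rule has_derivative_compose[OF dP has_derivative_partial[OF f]])
  then show ?thesis by (simp add: has_vector_derivative_def scaleR_sum_right)
qed

text \<open>The chain rule followed by the compatibility of the entropy pair: the Jacobian of \<open>f\<close> is moved from the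
  left factor to the velocity of the state, where it produces the derivative of the flux.\<close>

lemma has_vector_derivative_entropy_flux_along:
  fixes f :: "real ^ 'm::finite \<Rightarrow> real ^ 'm" and U F :: "real ^ 'm \<Rightarrow> real"
  assumes f: "f differentiable (at (vpoly P y))" and F: "F differentiable (at (vpoly P y))"
    and compat: "grad F (vpoly P y) = grad U (vpoly P y) v* matrix (frechet_derivative f (at (vpoly P y)))"
  shows "((\<lambda>y. F (vpoly P y)) has_vector_derivative
    grad U (vpoly P y) \<bullet> (\<Sum>i\<in>UNIV. poly (pderiv (P i)) y *\<^sub>R partial i f (vpoly P y))) (at y within S)"
proof -
  let ?w = "vpoly P y" and ?p = "vpoly (\<lambda>i. pderiv (P i)) y"
  have dP: "(vpoly P has_derivative (\<lambda>r. r *\<^sub>R ?p)) (at y within S)"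
    using has_vector_derivative_vpoly[of P y S] by (simp add: has_vector_derivative_def)
  have "((\<lambda>y. F (vpoly P y)) has_derivative (\<lambda>r. grad F ?w \<bullet> (r *\<^sub>R ?p))) (at y within S)"
    by (rule has_derivative_compose[OF dP has_derivative_grad[OF F]])
  moreover have "grad F ?w \<bullet> ?p = grad U ?w \<bullet> (\<Sum>i\<in>UNIV. poly (pderiv (P i)) y *\<^sub>R partial i f ?w)"
  proof -
    have D: "frechet_derivative f (at ?w) = (\<lambda>h. \<Sum>i\<in>UNIV. h $ i *\<^sub>R partial i f ?w)"
      using frechet_derivative_at[OF has_derivative_partial[OF f]] by simp
    have "linear (frechet_derivative f (at ?w))"
      using f linear_frechet_derivative by blast
    then have "matrix (frechet_derivative f (at ?w)) *v ?p = frechet_derivative f (at ?w) ?p"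
      by (metis matrix_vector_mul(2))
    also have "\<dots> = (\<Sum>i\<in>UNIV. poly (pderiv (P i)) y *\<^sub>R partial i f ?w)" by (simp add: D)
    finally show ?thesis by (simp add: compat dot_lmul_matrix)
  qed
  ultimately show ?thesis by (simp add: has_vector_derivative_def)
qed

lemma continuous_on_flux_derivative:
  assumes "\<And>i. continuous_on \<Omega> (partial i f)" and "\<And>y. y \<in> S \<Longrightarrow> vpoly P y \<in> \<Omega>"
  shows "continuous_on S (\<lambda>y. \<Sum>i\<in>UNIV. poly (pderiv (P i)) y *\<^sub>R partial i f (vpoly P y))"
  by (intro continuous_intros continuous_on_compose2[OF assms(1) continuous_on_vpoly] image_subsetI assms(2))

text \<open>Integration by parts moves the derivative from the projected entropy variables to the flux. Against
  \<open>\<nabla>U\<close> itself the flux derivative is the exact derivative of \<open>F\<close>. The remaining integral pairs the flux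
  derivative with the projection error of \<open>\<nabla>U\<close>, which is orthogonal to polynomials, so the projection of the flux
  derivative may be subtracted from the other factor.\<close>

lemma flux_volume_term:
  fixes f :: "real ^ 'm::finite \<Rightarrow> real ^ 'm" and U F :: "real ^ 'm \<Rightarrow> real"
  assumes ab: "a < b"
    and f: "\<And>w. w \<in> \<Omega> \<Longrightarrow> f differentiable (at w)" "\<And>i. continuous_on \<Omega> (partial i f)"
    and F: "\<And>w. w \<in> \<Omega> \<Longrightarrow> F differentiable (at w)"
      "\<And>w. w \<in> \<Omega> \<Longrightarrow> grad F w = grad U w v* matrix (frechet_derivative f (at w))"
    and U: "continuous_on \<Omega> (grad U)"
    and P: "\<And>y. y \<in> {a..b} \<Longrightarrow> vpoly P y \<in> \<Omega>"
    and fx: "fx = (\<lambda>y. \<Sum>i\<in>UNIV. poly (pderiv (P i)) y *\<^sub>R partial i f (vpoly P y))"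
    and q: "is_projection k a b (\<lambda>y. grad U (vpoly P y)) q"
    and r: "is_projection k a b fx r"
  shows "integral {a..b} (\<lambda>y. f (vpoly P y) \<bullet> vpoly (\<lambda>i. pderiv (q i)) y)
    = f (vpoly P b) \<bullet> vpoly q b - f (vpoly P a) \<bullet> vpoly q a - (F (vpoly P b) - F (vpoly P a))
      + integral {a..b} (\<lambda>y. (fx y - vpoly r y) \<bullet> (grad U (vpoly P y) - vpoly q y))"
proof -
  have df: "((\<lambda>y. f (vpoly P y)) has_vector_derivative fx y) (at y within {a..b})" if "y \<in> {a..b}" for y
    unfolding fx by (rule has_vector_derivative_flux_along[OF f(1)[OF P[OF that]]])
  have dF: "((\<lambda>y. F (vpoly P y)) has_vector_derivative (grad U (vpoly P y) \<bullet> fx y)) (at y within {a..b})"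
    if "y \<in> {a..b}" for y
    unfolding fx using P[OF that] by (intro has_vector_derivative_entropy_flux_along f F)
  let ?w = "\<lambda>y. grad U (vpoly P y)"
  have cw: "continuous_on {a..b} ?w"
    by (rule continuous_on_compose2[OF U continuous_on_vpoly]) (use P in auto)
  have cfx: "continuous_on {a..b} fx" unfolding fx by (rule continuous_on_flux_derivative[OF f(2) P])
  have cf: "continuous_on {a..b} (\<lambda>y. f (vpoly P y))"
    by (rule continuous_on_vector_derivative[OF df])
  have "((\<lambda>y. f (vpoly P y) \<bullet> vpoly (\<lambda>i. pderiv (q i)) y + fx y \<bullet> vpoly q y) has_integral
      f (vpoly P b) \<bullet> vpoly q b - f (vpoly P a) \<bullet> vpoly q a) {a..b}"
    by (intro fundamental_theorem_of_calculus bounded_bilinear.has_vector_derivative[OF bounded_bilinear_inner] df has_vector_derivative_vpoly)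
      (use ab in auto)
  then have parts: "integral {a..b} (\<lambda>y. f (vpoly P y) \<bullet> vpoly (\<lambda>i. pderiv (q i)) y) + integral {a..b} (\<lambda>y. fx y \<bullet> vpoly q y)
      = f (vpoly P b) \<bullet> vpoly q b - f (vpoly P a) \<bullet> vpoly q a"
    by (subst integral_add[symmetric]) (auto intro!: integrable_continuous_real continuous_intros cf cfx integral_unique)
  have "((\<lambda>y. ?w y \<bullet> fx y) has_integral F (vpoly P b) - F (vpoly P a)) {a..b}"
    by (intro fundamental_theorem_of_calculus dF) (use ab in auto)
  then have exact: "integral {a..b} (\<lambda>y. ?w y \<bullet> fx y) = F (vpoly P b) - F (vpoly P a)"
    by (rule integral_unique)
  have orth: "integral {a..b} (\<lambda>y. vpoly q y \<bullet> vpoly r y) = integral {a..b} (\<lambda>y. ?w y \<bullet> vpoly r y)"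
    by (rule is_projection_inner[OF cw q]) (use r in \<open>auto simp: is_projection_def\<close>)
  have "((\<lambda>y. ?w y \<bullet> fx y - fx y \<bullet> vpoly q y - (?w y \<bullet> vpoly r y - vpoly q y \<bullet> vpoly r y)) has_integral
      integral {a..b} (\<lambda>y. ?w y \<bullet> fx y) - integral {a..b} (\<lambda>y. fx y \<bullet> vpoly q y)
        - (integral {a..b} (\<lambda>y. ?w y \<bullet> vpoly r y) - integral {a..b} (\<lambda>y. vpoly q y \<bullet> vpoly r y))) {a..b}"
    by (intro has_integral_diff integrable_integral integrable_continuous_real continuous_intros cw cfx)
  moreover have "(\<lambda>y. ?w y \<bullet> fx y - fx y \<bullet> vpoly q y - (?w y \<bullet> vpoly r y - vpoly q y \<bullet> vpoly r y))
      = (\<lambda>y. (fx y - vpoly r y) \<bullet> (?w y - vpoly q y))"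
    by (auto simp: inner_diff_left inner_diff_right inner_commute)
  ultimately have "integral {a..b} (\<lambda>y. (fx y - vpoly r y) \<bullet> (?w y - vpoly q y))
      = integral {a..b} (\<lambda>y. ?w y \<bullet> fx y) - integral {a..b} (\<lambda>y. fx y \<bullet> vpoly q y)"
    using orth by (simp add: integral_unique)
  then show ?thesis using parts exact by simp
qed

text \<open>Pythagoras: the projection error is orthogonal to the difference of the two polynomials.\<close>

lemma projection_best_approximation:
  fixes g :: "real \<Rightarrow> real ^ 'm::finite"
  assumes g: "continuous_on {a..b} g" and q: "is_projection k a b g q" and r: "\<And>i. degree (r i) \<le> k"
  shows "L2_norm {a..b} (\<lambda>y. g y - vpoly q y) \<le> L2_norm {a..b} (\<lambda>y. g y - vpoly r y)"
proof -
  have dq: "degree (q i) \<le> k" for i using q by (simp add: is_projection_def)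
  define d where "d = (\<lambda>i. q i - r i)"
  have d: "vpoly d y = vpoly q y - vpoly r y" for y by (simp add: d_def vec_eq_iff)
  have orth: "integral {a..b} (\<lambda>y. vpoly q y \<bullet> vpoly d y) = integral {a..b} (\<lambda>y. g y \<bullet> vpoly d y)"
    by (rule is_projection_inner[OF g q]) (auto simp: d_def intro!: degree_diff_le dq r)
  have "((\<lambda>y. (norm (g y - vpoly q y))\<^sup>2 + (norm (vpoly d y))\<^sup>2 + 2 * (g y \<bullet> vpoly d y - vpoly q y \<bullet> vpoly d y)) has_integral
      integral {a..b} (\<lambda>y. (norm (g y - vpoly q y))\<^sup>2) + integral {a..b} (\<lambda>y. (norm (vpoly d y))\<^sup>2)
        + 2 * (integral {a..b} (\<lambda>y. g y \<bullet> vpoly d y) - integral {a..b} (\<lambda>y. vpoly q y \<bullet> vpoly d y))) {a..b}"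
    by (intro has_integral_add has_integral_diff has_integral_mult_right integrable_integral
        integrable_continuous_real continuous_intros g)
  moreover have "(norm (g y - vpoly q y))\<^sup>2 + (norm (vpoly d y))\<^sup>2 + 2 * (g y \<bullet> vpoly d y - vpoly q y \<bullet> vpoly d y)
      = (norm (g y - vpoly r y))\<^sup>2" for y
    by (simp add: d power2_norm_eq_inner inner_diff_left inner_diff_right inner_commute)
  ultimately have "integral {a..b} (\<lambda>y. (norm (g y - vpoly r y))\<^sup>2)
      = integral {a..b} (\<lambda>y. (norm (g y - vpoly q y))\<^sup>2) + integral {a..b} (\<lambda>y. (norm (vpoly d y))\<^sup>2)"
    using orth by (simp add: integral_unique)
  moreover have "0 \<le> integral {a..b} (\<lambda>y. (norm (vpoly d y))\<^sup>2)"
    by (intro integral_nonneg integrable_continuous_real continuous_intros) simp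
  ultimately show ?thesis by (simp add: L2_norm_def)
qed

text \<open>The competitor is the first-order Taylor polynomial of the entropy variables at the cell average: its degree
  does not exceed that of the state, and its error is quadratic in the deviation from the average.
  The inverse inequality turns the \<open>L\<^sup>4\<close>-norm of the deviation into its \<open>L\<^sup>2\<close>-norm.\<close>

lemma entropy_variable_projection_error:
  fixes U :: "real ^ 'm::finite \<Rightarrow> real"
  assumes ab: "a < b" and U: "convex_entropy \<Omega> U" and K: "compact K" "K \<subseteq> \<Omega>" "convex K"
    and P: "\<And>i. degree (P i) \<le> k" "\<And>y. y \<in> {a..b} \<Longrightarrow> vpoly P y \<in> K" and c: "c \<in> K"
    and q: "is_projection k a b (\<lambda>y. grad U (vpoly P y)) q"
  shows "L2_norm {a..b} (\<lambda>y. grad U (vpoly P y) - vpoly q y)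
    \<le> real CARD('m) powr (3/2) / 2 * max_d3 U K
        * (Ck_const k / sqrt (b - a) * integral {a..b} (\<lambda>y. (norm (vpoly P y - c))\<^sup>2))"
proof -
  define \<kappa> where "\<kappa> = real CARD('m) powr (3/2) / 2 * max_d3 U K"
  have "0 \<le> max_d3 U K"
    using abs_third_partial_le_max_d3[OF U K(1,2) c] by (meson abs_ge_zero order_trans)
  then have \<kappa>: "\<kappa> \<ge> 0" by (simp add: \<kappa>_def)
  define r where "r = (\<lambda>l. [:partial l U c:] + (\<Sum>i\<in>UNIV. smult (partial i (partial l U) c) (P i - [:c $ i:])))"
  have dr: "degree (r l) \<le> k" for l
    unfolding r_def
    by (intro degree_add_le degree_sum_le order_trans[OF degree_smult_le] degree_diff_le P) auto
  have r: "vpoly r y = (\<chi> l. partial l U c + (\<Sum>i\<in>UNIV. (vpoly P y - c) $ i * partial i (partial l U) c))" for y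
    by (simp add: vec_eq_iff r_def poly_sum mult.commute)
  define z where "z = (\<lambda>y. vpoly P y - c)"
  define p where "p = (\<lambda>i. P i - [:c $ i:])"
  have cw: "continuous_on {a..b} (\<lambda>y. grad U (vpoly P y))"
    by (rule continuous_on_compose2[OF continuous_on_grad[OF U] continuous_on_vpoly]) (use P K in auto)
  have cz: "continuous_on {a..b} z" unfolding z_def by (intro continuous_intros)
  have "L2_norm {a..b} (\<lambda>y. grad U (vpoly P y) - vpoly q y) \<le> L2_norm {a..b} (\<lambda>y. grad U (vpoly P y) - vpoly r y)"
    by (rule projection_best_approximation[OF cw q dr])
  also have "\<dots> \<le> sqrt (integral {a..b} (\<lambda>y. \<kappa>\<^sup>2 * norm (z y) ^ 4))"
    unfolding L2_norm_def
  proof (intro real_sqrt_le_mono integral_le integrable_continuous_real continuous_intros cw cz)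
    fix y assume y: "y \<in> {a..b}"
    have "norm (grad U (vpoly P y) - vpoly r y) \<le> \<kappa> * (norm (z y))\<^sup>2"
      unfolding r z_def \<kappa>_def by (rule grad_taylor[OF U K c P(2)[OF y]])
    then have "(norm (grad U (vpoly P y) - vpoly r y))\<^sup>2 \<le> (\<kappa> * (norm (z y))\<^sup>2)\<^sup>2"
      by (intro power_mono) auto
    then show "(norm (grad U (vpoly P y) - vpoly r y))\<^sup>2 \<le> \<kappa>\<^sup>2 * norm (z y) ^ 4"
      by (simp add: power_mult_distrib)
  qed
  also have "\<dots> = \<kappa> * sqrt (integral {a..b} (\<lambda>y. norm (z y) ^ 4))"
    using \<kappa> by (simp add: real_sqrt_mult)
  also have "\<dots> \<le> \<kappa> * (Ck_const k / sqrt (b - a) * integral {a..b} (\<lambda>y. (norm (z y))\<^sup>2))"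
  proof (rule mult_left_mono[OF _ \<kappa>])
    show "sqrt (integral {a..b} (\<lambda>y. norm (z y) ^ 4)) \<le> Ck_const k / sqrt (b - a) * integral {a..b} (\<lambda>y. (norm (z y))\<^sup>2)"
      by (rule L4_le_L2_vec[OF ab, of p]) (auto simp: p_def z_def intro!: degree_diff_le P)
  qed
  finally show ?thesis by (simp add: \<kappa>_def z_def)
qed

text \<open>Testing the damping term with the projected entropy variables gives the same value as testing with the entropy
  variables themselves, since the deviation from the average is a polynomial; subtracting the constant \<open>\<nabla>U\<close> at the
  average changes nothing either, and strong monotonicity of \<open>\<nabla>U\<close> applies.\<close>

lemma damping_coercive:
  fixes U :: "real ^ 'm::finite \<Rightarrow> real"
  assumes ab: "a < b" and \<Omega>: "open \<Omega>" and U: "convex_entropy \<Omega> U" and K: "compact K" "K \<subseteq> \<Omega>" "convex K"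
    and P: "\<And>i. degree (P i) \<le> k" "\<And>y. y \<in> {a..b} \<Longrightarrow> vpoly P y \<in> K"
    and c: "c \<in> K" "c = (1 / (b - a)) *\<^sub>R integral {a..b} (vpoly P)"
    and q: "is_projection k a b (\<lambda>y. grad U (vpoly P y)) q"
  defines "Q \<equiv> integral {a..b} (\<lambda>y. (norm (vpoly P y - c))\<^sup>2)"
    and "G \<equiv> integral {a..b} (\<lambda>y. (vpoly P y - c) \<bullet> vpoly q y)"
  shows "min_sigma U K * Q \<le> G" and "Q = 0 \<Longrightarrow> G = 0"
proof -
  let ?w = "\<lambda>y. grad U (vpoly P y)"
  have cw: "continuous_on {a..b} ?w"
    by (rule continuous_on_compose2[OF continuous_on_grad[OF U] continuous_on_vpoly]) (use P K in auto)
  define p where "p = (\<lambda>i. P i - [:c $ i:])"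
  have p: "vpoly p y = vpoly P y - c" for y by (simp add: p_def vec_eq_iff)
  have "G = integral {a..b} (\<lambda>y. vpoly q y \<bullet> vpoly p y)" by (simp add: G_def p inner_commute)
  also have "\<dots> = integral {a..b} (\<lambda>y. ?w y \<bullet> vpoly p y)"
    by (rule is_projection_inner[OF cw q]) (auto simp: p_def intro!: degree_diff_le P)
  finally have G: "G = integral {a..b} (\<lambda>y. vpoly p y \<bullet> ?w y)" by (simp add: inner_commute)
  have mean: "((\<lambda>y. vpoly p y \<bullet> grad U c) has_integral 0) {a..b}"
  proof -
    have "(vpoly P has_integral (b - a) *\<^sub>R c) {a..b}"
    proof -
      have "integral {a..b} (vpoly P) = (b - a) *\<^sub>R c" using ab c(2) by simp
      then show ?thesis
        using integrable_integral[OF integrable_continuous_real[OF continuous_on_vpoly[of "{a..b}" P]]] by simp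
    qed
    moreover have "((\<lambda>y. c) has_integral (b - a) *\<^sub>R c) {a..b}"
      using has_integral_const_real[of c a b] ab by simp
    ultimately have "((\<lambda>y. vpoly P y - c) has_integral (b - a) *\<^sub>R c - (b - a) *\<^sub>R c) {a..b}"
      by (rule has_integral_diff)
    from has_integral_linear[OF this bounded_linear_inner_left[of "grad U c"]] show ?thesis
      by (simp add: o_def p)
  qed
  have "((\<lambda>y. vpoly p y \<bullet> ?w y) has_integral G) {a..b}"
    unfolding G by (intro integrable_integral integrable_continuous_real continuous_intros cw)
  from has_integral_diff[OF this mean]
  have G': "((\<lambda>y. vpoly p y \<bullet> (?w y - grad U c)) has_integral G) {a..b}"
    by (simp add: inner_diff_right)
  have "((\<lambda>y. min_sigma U K * (norm (vpoly P y - c))\<^sup>2) has_integral min_sigma U K * Q) {a..b}"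
    unfolding Q_def
    by (intro has_integral_mult_right integrable_integral integrable_continuous_real continuous_intros)
  then show "min_sigma U K * Q \<le> G"
    using G' by (rule has_integral_le) (use grad_strongly_monotone[OF \<Omega> U K c(1)] P(2) in \<open>simp add: p\<close>)
  show "G = 0" if "Q = 0"
  proof -
    have "\<forall>y\<in>{a..b}. (norm (vpoly P y - c))\<^sup>2 = 0"
      using that ab unfolding Q_def by (subst (asm) integral_eq_0_iff) (auto intro!: continuous_intros)
    then have "G = integral {a..b} (\<lambda>y. 0)" unfolding G_def by (intro integral_cong) auto
    then show ?thesis by simp
  qed
qed

text \<open>The coefficient multiplying \<open>G\<close> is the left-hand side divided by \<open>\<sigma> * Q\<close>, so there is
  equality for \<open>G = \<sigma> * Q\<close>. For larger \<open>G\<close> it persists as soon as the coefficient is nonnegative. This is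
  where the sign of \<open>\<beta>\<close> matters: nonnegativity of the trace bound makes \<open>\<beta>\<close> nonnegative unless \<open>M\<close> or
  \<open>Q\<close> vanishes, and then both sides are zero.\<close>

lemma damping_absorbs_defects:
  fixes \<tau> h \<sigma> M C S H Q G \<beta> :: real
  assumes pos: "0 < \<tau>" "0 < h" "0 < \<sigma>" and nn: "0 \<le> M" "0 \<le> C" "0 \<le> S" "0 \<le> H" "0 \<le> Q"
    and R: "0 \<le> \<tau> * \<beta> / (2 * h) * M * Q" and G: "\<sigma> * Q \<le> G" "Q = 0 \<Longrightarrow> G = 0"
  shows "H * (\<tau> * \<beta> / (2 * h) * M * Q) + S * (\<tau> / 2 * M * (C / sqrt h * Q))
    \<le> \<tau> / 2 * (M / \<sigma>) * (C / sqrt h * S + \<beta> / h * H) * G"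
proof -
  define B where "B = \<tau> / 2 * (M / \<sigma>) * (C / sqrt h * S + \<beta> / h * H)"
  have "\<sigma> * B = \<tau> / 2 * M * (C / sqrt h * S + \<beta> / h * H)" using pos by (simp add: B_def)
  then have "(\<sigma> * B) * Q = (\<tau> / 2 * M * (C / sqrt h * S + \<beta> / h * H)) * Q" by simp
  then have lhs: "H * (\<tau> * \<beta> / (2 * h) * M * Q) + S * (\<tau> / 2 * M * (C / sqrt h * Q)) = B * (\<sigma> * Q)"
    by (simp add: algebra_simps)
  consider "Q = 0" | "M = 0" | "Q > 0" "M > 0" using nn by linarith
  then have "B * (\<sigma> * Q) \<le> B * G"
  proof cases
    case 3
    then have "0 \<le> \<beta>"
      using R pos by (simp add: zero_le_mult_iff zero_le_divide_iff)
    then have "B \<ge> 0" unfolding B_def using pos nn by (intro mult_nonneg_nonneg add_nonneg_nonneg divide_nonneg_nonneg) auto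
    then show ?thesis using G(1) by (rule mult_left_mono[rotated])
  qed (auto simp: B_def G(2))
  then show ?thesis unfolding lhs by (simp add: B_def)
qed

section \<open>The entropy inequality\<close>

lemma state_on_cell:
  assumes m: "mesh N x" and v: "v \<in> Vkm k N x" and st: "states_in N x \<Omega> v" and j: "j \<in> {1..N}"
  obtains P where "\<And>i. degree (P i) \<le> k" "\<And>y. y \<in> open_cell x j \<Longrightarrow> v y = vpoly P y"
    "cell_range x j v = vpoly P ` cell x j" "convex hull (vpoly P ` cell x j) \<subseteq> \<Omega>"
    "right_lim v (x (j - 1)) = vpoly P (x (j - 1))" "left_lim v (x j) = vpoly P (x j)"
proof -
  obtain P where P: "\<And>i. degree (P i) \<le> k" "\<And>y. y \<in> open_cell x j \<Longrightarrow> v y = vpoly P y"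
    using Vkm_on_cell[OF v j] by blast
  note ab = mesh_cell[OF m j]
  have r: "right_lim v (x (j - 1)) = vpoly P (x (j - 1))"
    by (rule right_lim_eq[OF ab continuous_on_vpoly P(2)])
  have l: "left_lim v (x j) = vpoly P (x j)"
    by (rule left_lim_eq[OF ab continuous_on_vpoly P(2)])
  have "cell x j = open_cell x j \<union> {x (j - 1), x j}" using ab by auto
  then have "vpoly P ` cell x j = vpoly P ` open_cell x j \<union> {vpoly P (x (j - 1)), vpoly P (x j)}"
    by (simp only: image_Un image_insert image_empty)
  moreover have "vpoly P ` open_cell x j = v ` open_cell x j"
    by (rule image_cong[OF refl P(2)[symmetric]])
  ultimately have c: "cell_range x j v = vpoly P ` cell x j"
    unfolding cell_range_def r l by simp
  then have "convex hull (vpoly P ` cell x j) \<subseteq> \<Omega>"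
    using st j unfolding states_in_def by (metis (no_types))
  then show ?thesis using that P c r l by blast
qed

lemma flux_deriv_on_cell:
  assumes f: "\<And>w. w \<in> \<Omega> \<Longrightarrow> f differentiable (at w)"
    and v: "\<And>y. y \<in> {a<..<b} \<Longrightarrow> v y = vpoly P y" and P: "\<And>y. y \<in> {a..b} \<Longrightarrow> vpoly P y \<in> \<Omega>" and y: "y \<in> {a<..<b}"
  shows "flux_deriv f v y = (\<Sum>i\<in>UNIV. poly (pderiv (P i)) y *\<^sub>R partial i f (vpoly P y))"
proof -
  have "vpoly P y \<in> \<Omega>" using P y by auto
  then have "((\<lambda>y. f (vpoly P y)) has_vector_derivative (\<Sum>i\<in>UNIV. poly (pderiv (P i)) y *\<^sub>R partial i f (vpoly P y))) (at y)"
    by (intro has_vector_derivative_flux_along f)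
  then have "((\<lambda>y. f (v y)) has_vector_derivative (\<Sum>i\<in>UNIV. poly (pderiv (P i)) y *\<^sub>R partial i f (vpoly P y))) (at y)"
    by (rule has_vector_derivative_transform_within_open[OF _ open_greaterThanLessThan y]) (simp add: v)
  then show ?thesis unfolding flux_deriv_def by (rule vector_derivative_at)
qed

text \<open>Regularity on every cell, not only on the one under consideration, because the projection is defined on the
  whole interval and exists only if all cells permit it.\<close>

lemma piecewise_continuous_along_state:
  assumes m: "mesh N x" and v: "v \<in> Vkm k N x" and st: "states_in N x \<Omega> v"
  shows piecewise_continuous_grad: "continuous_on \<Omega> (grad U) \<Longrightarrow> piecewise_continuous N x (\<lambda>y. grad U (v y) - c)"
    and piecewise_continuous_flux_deriv:
      "(\<And>w. w \<in> \<Omega> \<Longrightarrow> f differentiable (at w)) \<Longrightarrow> (\<And>i. continuous_on \<Omega> (partial i f))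
        \<Longrightarrow> piecewise_continuous N x (flux_deriv f v)"
proof -
  show "piecewise_continuous N x (\<lambda>y. grad U (v y) - c)" if g: "continuous_on \<Omega> (grad U)"
    unfolding piecewise_continuous_def
  proof
    fix j assume j: "j \<in> {1..N}"
    obtain P where P: "\<And>y. y \<in> open_cell x j \<Longrightarrow> v y = vpoly P y" "convex hull (vpoly P ` cell x j) \<subseteq> \<Omega>"
      using state_on_cell[OF m v st j] by metis
    have "vpoly P ` cell x j \<subseteq> \<Omega>" by (rule order_trans[OF hull_subset P(2)])
    then have "continuous_on (cell x j) (\<lambda>y. grad U (vpoly P y) - c)"
      by (intro continuous_intros continuous_on_compose2[OF g continuous_on_vpoly])
    then show "\<exists>G. continuous_on (cell x j) G \<and> (\<forall>y\<in>open_cell x j. grad U (v y) - c = G y)"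
      using P(1) by (intro exI[of _ "\<lambda>y. grad U (vpoly P y) - c"]) simp
  qed
  show "piecewise_continuous N x (flux_deriv f v)"
    if f: "\<And>w. w \<in> \<Omega> \<Longrightarrow> f differentiable (at w)" "\<And>i. continuous_on \<Omega> (partial i f)"
    unfolding piecewise_continuous_def
  proof
    fix j assume j: "j \<in> {1..N}"
    obtain P where P: "\<And>y. y \<in> open_cell x j \<Longrightarrow> v y = vpoly P y" "convex hull (vpoly P ` cell x j) \<subseteq> \<Omega>"
      using state_on_cell[OF m v st j] by metis
    have sub: "vpoly P y \<in> \<Omega>" if "y \<in> cell x j" for y
      by (rule subsetD[OF P(2) hull_inc]) (use that in simp)
    let ?G = "\<lambda>y. \<Sum>i\<in>UNIV. poly (pderiv (P i)) y *\<^sub>R partial i f (vpoly P y)"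
    have "continuous_on (cell x j) ?G"
      by (rule continuous_on_flux_derivative[OF f(2) sub])
    moreover have "\<forall>y\<in>open_cell x j. flux_deriv f v y = ?G y"
      using flux_deriv_on_cell[OF f(1) P(1) sub] by blast
    ultimately show "\<exists>G. continuous_on (cell x j) G \<and> (\<forall>y\<in>open_cell x j. flux_deriv f v y = G y)" by blast
  qed
qed

lemma at_within_interval_not_bot:
  fixes T :: "real set"
  assumes "is_interval T" "interior T \<noteq> {}" "t \<in> T"
  shows "at t within T \<noteq> bot"
proof -
  have "T \<noteq> {y}" for y using assms(2) by auto
  then have "t islimpt T"
    using assms by (intro connected_imp_perfect) (auto simp: is_interval_connected_1)
  then show ?thesis using trivial_limit_within by blast
qed

theorem theorem4p4:
  fixes \<Omega> :: "(real ^ 'm::finite) set"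
    and f :: "real ^ 'm \<Rightarrow> real ^ 'm"
    and U F :: "real ^ 'm \<Rightarrow> real"
    and fhat :: "real ^ 'm \<Rightarrow> real ^ 'm \<Rightarrow> real ^ 'm"
    and k N :: nat
    and x :: "nat \<Rightarrow> real"
    and \<beta> :: real
    and T :: "real set"
    and uL uR :: "real \<Rightarrow> real ^ 'm"
    and u :: "real \<Rightarrow> real \<Rightarrow> real ^ 'm"
  assumes "open \<Omega>" and "smooth_on f \<Omega>" and "entropy_pair \<Omega> f U F"
    and "mesh N x" and "k \<ge> 1"
    and "trace_constant TYPE('m) k \<beta>"
    and "entropy_stable \<Omega> f U F fhat"
    and "is_interval T" and "interior T \<noteq> {}"
    and "\<And>t. t \<in> T \<Longrightarrow> states_in N x \<Omega> (u t)"
    and "\<And>t. t \<in> T \<Longrightarrow> uL t \<in> \<Omega> \<and> uR t \<in> \<Omega>"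
    and "scheme_solution k \<beta> N x f U fhat uL uR T u"
  shows "\<forall>t\<in>T. \<forall>j\<in>{1..N}. \<exists>D.
           ((\<lambda>s. integral (cell x j) (\<lambda>y. U (u s y))) has_real_derivative D) (at t within T) \<and>
           D + num_flux_at N x (entropy_flux f U F fhat) (uL t) (uR t) (u t) j
             - num_flux_at N x (entropy_flux f U F fhat) (uL t) (uR t) (u t) (j - 1) \<le> 0"
proof (intro ballI)
  fix t j assume t: "t \<in> T" and j: "j \<in> {1..N}"
  note \<Omega> = \<open>open \<Omega>\<close> and m = \<open>mesh N x\<close>
  have U: "convex_entropy \<Omega> U"
    and F: "\<And>w. w \<in> \<Omega> \<Longrightarrow> F differentiable (at w)"
      "\<And>w. w \<in> \<Omega> \<Longrightarrow> grad F w = grad U w v* matrix (frechet_derivative f (at w))"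
    using \<open>entropy_pair \<Omega> f U F\<close> by (auto simp: entropy_pair_def)
  have f: "\<And>w. w \<in> \<Omega> \<Longrightarrow> f differentiable (at w)" "\<And>i. continuous_on \<Omega> (partial i f)"
    using \<open>smooth_on f \<Omega>\<close>[unfolded smooth_on_def, rule_format, of 1] by auto
  note cg = continuous_on_grad[OF U]
  have st: "states_in N x \<Omega> (u s)" if "s \<in> T" for s using assms(10) that by blast
  have uV: "u s \<in> Vkm k N x" if "s \<in> T" for s
    using assms(12) that by (simp add: scheme_solution_def)

  define a b where "a = x (j - 1)" and "b = x j"
  note ab_def = a_def b_def
  have ab: "a < b" unfolding ab_def by (rule mesh_cell[OF m j])
  obtain P where P: "\<And>i. degree (P i) \<le> k" "\<And>y. y \<in> {a<..<b} \<Longrightarrow> u t y = vpoly P y"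
    and range: "cell_range x j (u t) = vpoly P ` {a..b}" and hull: "convex hull (vpoly P ` {a..b}) \<subseteq> \<Omega>"
    and ua: "right_lim (u t) a = vpoly P a" and ub: "left_lim (u t) b = vpoly P b"
    unfolding ab_def using state_on_cell[OF m uV[OF t] st[OF t] j] by metis
  define K where "K = convex hull (cell_range x j (u t))"
  have K: "compact K" "K \<subseteq> \<Omega>" "convex K"
    using hull unfolding K_def range
    by (auto intro!: compact_convex_hull compact_continuous_image continuous_intros)
  have PK: "vpoly P y \<in> K" if "y \<in> {a..b}" for y
    unfolding K_def range by (rule hull_inc) (use that in simp)
  have P\<Omega>: "vpoly P y \<in> \<Omega>" if "y \<in> {a..b}" for y using PK K that by blast
  define c where "c = cell_avg x j (u t)"
  have c_eq: "c = (1 / (b - a)) *\<^sub>R integral {a..b} (vpoly P)"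
    unfolding c_def cell_avg_def ab_def[symmetric] by (subst integral_cong_Ioo[OF P(2)]) auto
  have c: "c \<in> K"
    unfolding c_eq by (intro average_in_convex ab continuous_intros compact_imp_closed K) (use PK in auto)

  define fx where "fx = (\<lambda>y. \<Sum>i\<in>UNIV. poly (pderiv (P i)) y *\<^sub>R partial i f (vpoly P y))"
  have fx: "flux_deriv f (u t) y = fx y" if "y \<in> {a<..<b}" for y
    unfolding fx_def by (rule flux_deriv_on_cell[OF f(1) P(2) P\<Omega> that])
  have cfx: "continuous_on {a..b} fx"
    unfolding fx_def by (rule continuous_on_flux_derivative[OF f(2) P\<Omega>])
  have cw: "continuous_on {a..b} (\<lambda>y. grad U (vpoly P y))"
    by (rule continuous_on_compose2[OF cg continuous_on_vpoly]) (use P\<Omega> in auto)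

  \<comment> \<open>The test function: the projected entropy variables.\<close>
  define v where "v = L2_proj_vec k N x (\<lambda>y. grad U (u t y))"
  have pcw: "piecewise_continuous N x (\<lambda>y. grad U (u t y) - d)" for d
    by (rule piecewise_continuous_grad[OF m uV[OF t] st[OF t] cg])
  have pcw0: "piecewise_continuous N x (\<lambda>y. grad U (u t y))" using pcw[of 0] by simp
  have vV: "v \<in> Vkm k N x" unfolding v_def by (rule L2_proj_vec_in_Vkm[OF m pcw0])
  obtain q where q0: "is_projection k a b (\<lambda>y. grad U (u t y)) q" and vq: "\<And>y. y \<in> {a<..<b} \<Longrightarrow> v y = vpoly q y"
    unfolding v_def ab_def using L2_proj_vec_on_cell[OF m pcw0 j, of k] by metis
  have q: "is_projection k a b (\<lambda>y. grad U (vpoly P y)) q"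
    by (rule is_projection_cong[OF _ q0]) (simp add: P(2))
  \<comment> \<open>Constants are reproduced by the projection, so the trace constant bounds the error of the traces of \<open>v\<close>.\<close>
  have trace: "right_lim (L2_proj_vec k N x (\<lambda>y. grad U (u t y) - d)) a = vpoly q a - d"
    "left_lim (L2_proj_vec k N x (\<lambda>y. grad U (u t y) - d)) b = vpoly q b - d" for d
  proof -
    obtain q' where q0': "is_projection k a b (\<lambda>y. grad U (u t y) - d) q'"
      and q': "\<And>y. y \<in> {a<..<b} \<Longrightarrow> L2_proj_vec k N x (\<lambda>y. grad U (u t y) - d) y = vpoly q' y"
      unfolding ab_def using L2_proj_vec_on_cell[OF m pcw j, of k] by metis
    have "is_projection k a b (\<lambda>y. grad U (vpoly P y) - d) q'"
      by (rule is_projection_cong[OF _ q0']) (simp add: P(2))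
    then have "q' = (\<lambda>i. q i - [:d $ i:])"
      using is_projection_unique[OF ab] is_projection_diff_const[OF cw q] by blast
    then have val: "vpoly q' y = vpoly q y - d" for y by (simp add: vec_eq_iff)
    show "right_lim (L2_proj_vec k N x (\<lambda>y. grad U (u t y) - d)) a = vpoly q a - d"
      using right_lim_eq[OF ab continuous_on_vpoly q'] val by simp
    show "left_lim (L2_proj_vec k N x (\<lambda>y. grad U (u t y) - d)) b = vpoly q b - d"
      using left_lim_eq[OF ab continuous_on_vpoly q'] val by simp
  qed
  obtain r where r0: "is_projection k a b (flux_deriv f (u t)) r"
    and vr: "\<And>y. y \<in> {a<..<b} \<Longrightarrow> L2_proj_vec k N x (flux_deriv f (u t)) y = vpoly r y"
    unfolding ab_def
    using L2_proj_vec_on_cell[OF m piecewise_continuous_flux_deriv[OF m uV[OF t] st[OF t] f] j, of k] by metis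
  have r: "is_projection k a b fx r"
    by (rule is_projection_cong[OF _ r0]) (simp add: fx)

  define u' where "u' = (\<lambda>y. vector_derivative (\<lambda>s. u s y) (at t within T))"
  have du: "((\<lambda>s. u s y) has_vector_derivative u' y) (at t within T)" if "y \<in> {a<..<b}" for y
    using assms(12) t j that unfolding scheme_solution_def u'_def ab_def
    by (simp add: vector_derivative_works[symmetric])
  obtain Y L where Y: "finite Y" "Y \<subseteq> {a<..<b}" "\<And>z. degree (L z) \<le> k"
    and interp: "\<And>p y. degree p \<le> k \<Longrightarrow> poly p y = (\<Sum>z\<in>Y. poly (L z) y * poly p z)"
    using lagrange_interpolation[OF ab, of k] by metis
  have vinterp: "vpoly p y = (\<Sum>z\<in>Y. poly (L z) y *\<^sub>R vpoly p z)" if "\<And>i. degree (p i) \<le> k" for p :: "'m \<Rightarrow> real poly" and y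
    by (simp add: vec_eq_iff) (intro allI interp that)
  have rep: "u s y = (\<Sum>z\<in>Y. poly (L z) y *\<^sub>R u s z)" if s: "s \<in> T" and y: "y \<in> {a<..<b}" for s y
  proof -
    obtain p where p: "\<And>i. degree (p i) \<le> k" "\<And>y. y \<in> {a<..<b} \<Longrightarrow> u s y = vpoly p y"
      unfolding ab_def using Vkm_on_cell[OF uV[OF s] j] by metis
    have "u s y = (\<Sum>z\<in>Y. poly (L z) y *\<^sub>R vpoly p z)" by (rule trans[OF p(2)[OF y] vinterp[OF p(1)]])
    also have "\<dots> = (\<Sum>z\<in>Y. poly (L z) y *\<^sub>R u s z)"
      by (intro sum.cong refl) (use p(2) Y(2) in auto)
    finally show ?thesis .
  qed
  have Pinterp: "(\<Sum>z\<in>Y. poly (L z) y *\<^sub>R u t z) = vpoly P y" for y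
  proof -
    have "(\<Sum>z\<in>Y. poly (L z) y *\<^sub>R u t z) = (\<Sum>z\<in>Y. poly (L z) y *\<^sub>R vpoly P z)"
      by (intro sum.cong refl) (use P(2) Y(2) in auto)
    also have "\<dots> = vpoly P y" by (rule vinterp[OF P(1), symmetric])
    finally show ?thesis .
  qed
  define d where "d = (\<lambda>i. \<Sum>z\<in>Y. smult (u' z $ i) (L z))"
  have d: "vpoly d y = (\<Sum>z\<in>Y. poly (L z) y *\<^sub>R u' z)" for y
    by (simp add: d_def vec_eq_iff poly_sum mult.commute)
  have dd: "degree (d i) \<le> k" for i
    unfolding d_def by (intro degree_sum_le Y order_trans[OF degree_smult_le])
  \<comment> \<open>The time derivative is again a polynomial on the cell, hence does not distinguish \<open>\<nabla>U(u)\<close> from its projection.\<close>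
  have u'd: "u' y = vpoly d y" if y: "y \<in> {a<..<b}" for y
  proof -
    have "((\<lambda>s. \<Sum>z\<in>Y. poly (L z) y *\<^sub>R u s z) has_vector_derivative (\<Sum>z\<in>Y. poly (L z) y *\<^sub>R u' z)) (at t within T)"
      by (intro has_vector_derivative_sum bounded_linear.has_vector_derivative[OF bounded_linear_scaleR_right] du)
        (use Y(2) in auto)
    then have "((\<lambda>s. u s y) has_vector_derivative vpoly d y) (at t within T)"
      unfolding d by (rule has_vector_derivative_transform[OF t rep[OF _ y], rotated])
    then show ?thesis
      using vector_derivative_unique_within[OF at_within_interval_not_bot[OF assms(8,9) t] du[OF y]] by blast
  qed
  define D where "D = integral {a..b} (\<lambda>y. vpoly d y \<bullet> vpoly q y)"
  have deriv: "((\<lambda>s. integral {a..b} (\<lambda>y. U (u s y))) has_real_derivative D) (at t within T)"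
  proof -
    have "((\<lambda>s. integral {a..b} (\<lambda>y. U (u s y))) has_real_derivative
        integral {a..b} (\<lambda>y. grad U (u t y) \<bullet> (\<Sum>z\<in>Y. poly (L z) y *\<^sub>R u' z))) (at t within T)"
      by (rule has_derivative_integral_entropy[OF ab \<Omega> convex_entropy_diff1[OF U] cg Y(1) rep t du])
        (use Y(2) Pinterp P\<Omega> in auto)
    also have "integral {a..b} (\<lambda>y. grad U (u t y) \<bullet> (\<Sum>z\<in>Y. poly (L z) y *\<^sub>R u' z))
        = integral {a..b} (\<lambda>y. grad U (vpoly P y) \<bullet> vpoly d y)"
      unfolding d by (rule integral_cong_Ioo) (simp add: P(2))
    also have "\<dots> = D"
      unfolding D_def is_projection_inner[OF cw q dd, symmetric] by (simp add: inner_commute)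
    finally show ?thesis .
  qed

  define B where "B = damping k \<beta> N x f U fhat (uL t) (uR t) (u t) j"
  define fl where "fl = num_flux_at N x fhat (uL t) (uR t) (u t)"
  define G where "G = integral {a..b} (\<lambda>y. (vpoly P y - c) \<bullet> vpoly q y)"
  have scheme: "D - integral {a..b} (\<lambda>y. f (vpoly P y) \<bullet> vpoly (\<lambda>i. pderiv (q i)) y)
      + fl j \<bullet> vpoly q b - fl (j - 1) \<bullet> vpoly q a = - B * G"
  proof -
    have "integral {a..b} (\<lambda>y. u' y \<bullet> v y) - integral {a..b} (\<lambda>y. f (u t y) \<bullet> vector_derivative v (at y))
        + fl j \<bullet> left_lim v b - fl (j - 1) \<bullet> right_lim v a = - B * integral {a..b} (\<lambda>y. (u t y - c) \<bullet> v y)"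
      using assms(12) t j vV unfolding scheme_solution_def u'_def ab_def fl_def B_def c_def by blast
    moreover have "integral {a..b} (\<lambda>y. u' y \<bullet> v y) = D"
      unfolding D_def by (rule integral_cong_Ioo) (simp add: u'd vq)
    moreover have "integral {a..b} (\<lambda>y. f (u t y) \<bullet> vector_derivative v (at y))
        = integral {a..b} (\<lambda>y. f (vpoly P y) \<bullet> vpoly (\<lambda>i. pderiv (q i)) y)"
    proof (rule integral_cong_Ioo)
      fix y assume y: "y \<in> {a<..<b}"
      have "(v has_vector_derivative vpoly (\<lambda>i. pderiv (q i)) y) (at y)"
        by (rule has_vector_derivative_transform_within_open[OF has_vector_derivative_vpoly open_greaterThanLessThan y])
          (simp add: vq)
      then show "f (u t y) \<bullet> vector_derivative v (at y) = f (vpoly P y) \<bullet> vpoly (\<lambda>i. pderiv (q i)) y"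
        by (simp add: vector_derivative_at P(2)[OF y])
    qed
    moreover have "left_lim v b = vpoly q b" by (rule left_lim_eq[OF ab continuous_on_vpoly vq])
    moreover have "right_lim v a = vpoly q a" by (rule right_lim_eq[OF ab continuous_on_vpoly vq])
    moreover have "integral {a..b} (\<lambda>y. (u t y - c) \<bullet> v y) = G"
      unfolding G_def by (rule integral_cong_Ioo) (simp add: P(2) vq)
    ultimately show ?thesis by simp
  qed

  define I where "I = integral {a..b} (\<lambda>y. (fx y - vpoly r y) \<bullet> (grad U (vpoly P y) - vpoly q y))"
  define Hp where "Hp = fl (j - 1) - f (vpoly P a)"
  define Hm where "Hm = - fl j + f (vpoly P b)"
  have balance: "D = Hp \<bullet> vpoly q a + Hm \<bullet> vpoly q b - (F (vpoly P b) - F (vpoly P a)) + I - B * G"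
    using scheme flux_volume_term[OF ab f F cg P\<Omega> fx_def q r]
    by (simp add: I_def Hp_def Hm_def inner_diff_left inner_add_left)

  let ?EF = "num_flux_at N x (entropy_flux f U F fhat) (uL t) (uR t) (u t)"
  have j0: "j \<noteq> 0" "j - 1 \<noteq> N" using j by auto
  have right_boundary: "Hm \<bullet> grad U (vpoly P b) - F (vpoly P b) = - ?EF j"
  proof -
    have "trace_minus x (uL t) (u t) j = vpoly P b" using j0 ub by (simp add: trace_minus_def ab_def)
    then show ?thesis
      by (simp add: Hm_def fl_def num_flux_at_def entropy_flux_def potential_def inner_diff_right inner_commute[of _ "grad U _"])
  qed
  \<comment> \<open>On the right the outgoing entropy flux is reproduced exactly, since it is built from the trace inside the cell; on the
    left it is built from the trace of the neighbour, and entropy stability bridges the jump.\<close>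
  have left_boundary: "Hp \<bullet> grad U (vpoly P a) + F (vpoly P a) \<le> ?EF (j - 1)"
  proof -
    define e where "e = trace_minus x (uL t) (u t) (j - 1)"
    have e: "e \<in> \<Omega>"
    proof (cases "j - 1 = 0")
      case True
      then show ?thesis using assms(11)[OF t] by (simp add: e_def trace_minus_def)
    next
      case False
      then have j1: "j - 1 \<in> {1..N}" using j by auto
      have "left_lim (u t) (x (j - 1)) \<in> convex hull (cell_range x (j - 1) (u t))"
        by (rule hull_inc) (simp add: cell_range_def)
      then show ?thesis
        using st[OF t] j1 False by (auto simp: states_in_def e_def trace_minus_def)
    qed
    have plus: "trace_plus N x (uR t) (u t) (j - 1) = vpoly P a" using j0 ua by (simp add: trace_plus_def ab_def)
    have flj: "fl (j - 1) = fhat e (vpoly P a)" by (simp only: fl_def num_flux_at_def plus e_def)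
    have "fhat e (vpoly P a) \<bullet> (grad U (vpoly P a) - grad U e) - (potential f U F (vpoly P a) - potential f U F e) \<le> 0"
      using assms(7) e P\<Omega>[of a] ab unfolding entropy_stable_def by auto
    moreover have "?EF (j - 1) = fhat e (vpoly P a) \<bullet> grad U e - potential f U F e"
      by (simp only: num_flux_at_def plus e_def[symmetric] entropy_flux_def inner_commute[of "grad U e"])
    moreover have "Hp \<bullet> grad U (vpoly P a) + F (vpoly P a)
        = fhat e (vpoly P a) \<bullet> grad U (vpoly P a) - potential f U F (vpoly P a)"
      unfolding Hp_def flj potential_def by (simp add: inner_diff_left inner_commute[of "grad U _"])
    ultimately show ?thesis by (simp add: inner_diff_right)
  qed

  define \<tau> where "\<tau> = real CARD('m) powr (3/2)"
  define M where "M = max_d3 U K"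
  define \<sigma> where "\<sigma> = min_sigma U K"
  define h where "h = b - a"
  define Q where "Q = integral {a..b} (\<lambda>y. (norm (vpoly P y - c))\<^sup>2)"
  define S where "S = L2_norm {a..b} (\<lambda>y. fx y - vpoly r y)"
  define R where "R = \<tau> * \<beta> / (2 * h) * M * Q"
  have B: "B = \<tau> / 2 * (M / \<sigma>) * (Ck_const k / sqrt h * S + \<beta> / h * (norm Hp + norm Hm))"
  proof -
    have "L2_norm {a..b} (\<lambda>y. flux_deriv f (u t) y - L2_proj_vec k N x (flux_deriv f (u t)) y) = S"
      unfolding S_def L2_norm_def by (intro arg_cong[of _ _ sqrt] integral_cong_Ioo) (simp add: fx vr)
    then show ?thesis
      unfolding B_def damping_def Let_def K_def[symmetric] fl_def[symmetric] ab_def[symmetric] ua ub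
      by (simp add: \<tau>_def M_def \<sigma>_def h_def Hp_def Hm_def)
  qed
  have R: "norm (vpoly q a - grad U (vpoly P a)) \<le> R" "norm (vpoly q b - grad U (vpoly P b)) \<le> R"
  proof -
    have Q': "integral {a..b} (\<lambda>y. (norm (u t y - c))\<^sup>2) = Q"
      unfolding Q_def by (rule integral_cong_Ioo) (simp add: P(2))
    have "mesh N x \<and> open \<Omega> \<and> convex_entropy \<Omega> U \<and> u t \<in> Vkm k N x \<and> states_in N x \<Omega> (u t)"
      using m \<Omega> U uV[OF t] st[OF t] by blast
    from assms(6)[unfolded trace_constant_def, rule_format, OF j this]
    show "norm (vpoly q a - grad U (vpoly P a)) \<le> R" "norm (vpoly q b - grad U (vpoly P b)) \<le> R"
      unfolding Let_def ab_def[symmetric] K_def[symmetric] c_def[symmetric] trace ua ub Q'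
      by (simp_all add: R_def \<tau>_def M_def h_def)
  qed
  have M0: "0 \<le> M"
    using abs_third_partial_le_max_d3[OF U K(1,2) c] unfolding M_def by (meson abs_ge_zero order_trans)
  have S0: "0 \<le> S" and Q0: "0 \<le> Q"
    unfolding S_def L2_norm_def Q_def
    by (auto intro!: integral_nonneg integrable_continuous_real continuous_intros cfx)
  have I_bound: "I \<le> S * (\<tau> / 2 * M * (Ck_const k / sqrt h * Q))"
  proof -
    have "I \<le> S * L2_norm {a..b} (\<lambda>y. grad U (vpoly P y) - vpoly q y)"
      unfolding I_def S_def by (intro integral_Cauchy_Schwarz_vec ab continuous_intros cfx cw)
    also have "\<dots> \<le> S * (\<tau> / 2 * M * (Ck_const k / sqrt h * Q))"
      unfolding \<tau>_def M_def h_def Q_def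
      by (rule mult_left_mono[OF entropy_variable_projection_error[OF ab U K P(1) PK c q] S0])
    finally show ?thesis .
  qed
  have "Hp \<bullet> (vpoly q a - grad U (vpoly P a)) \<le> norm Hp * R" "Hm \<bullet> (vpoly q b - grad U (vpoly P b)) \<le> norm Hm * R"
    by (intro order_trans[OF norm_cauchy_schwarz] mult_left_mono R norm_ge_zero)+
  moreover have "(norm Hp + norm Hm) * R + S * (\<tau> / 2 * M * (Ck_const k / sqrt h * Q)) \<le> B * G"
    unfolding B R_def
  proof (rule damping_absorbs_defects)
    show "0 < \<tau>" "0 < h" using ab by (simp_all add: \<tau>_def h_def)
    show "0 < \<sigma>" unfolding \<sigma>_def by (rule min_sigma_pos[OF \<Omega> U K(1,2)]) (use c in blast)
    show "0 \<le> \<tau> * \<beta> / (2 * h) * M * Q"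
      using order_trans[OF norm_ge_zero R(1)] by (simp add: R_def)
    show "\<sigma> * Q \<le> G" "Q = 0 \<Longrightarrow> G = 0"
      unfolding \<sigma>_def Q_def G_def using damping_coercive[OF ab \<Omega> U K P(1) PK c c_eq q] by blast+
  qed (use M0 S0 Q0 Ck_const_nonneg in auto)
  ultimately have "Hp \<bullet> (vpoly q a - grad U (vpoly P a)) + Hm \<bullet> (vpoly q b - grad U (vpoly P b)) + I - B * G \<le> 0"
    using I_bound by (simp add: distrib_right)
  then have "D + ?EF j - ?EF (j - 1) \<le> 0"
    using balance right_boundary left_boundary by (simp add: inner_diff_right)
  then show "\<exists>D. ((\<lambda>s. integral (cell x j) (\<lambda>y. U (u s y))) has_real_derivative D) (at t within T) \<and>
      D + ?EF j - ?EF (j - 1) \<le> 0"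
    using deriv unfolding ab_def by blast
qed

end
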